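(* Let $\mathcal{F}$ be a family of subsets of $X=\{1,2,3,4\}$. Then $\mathfrak{fr}(\mathcal{F})=\mathfrak{no}(\mathcal{F})$. More precisely, if $\mathcal{F}$ is closed under intersections (including the empty intersection, so that $X\in\mathcal{F}$), then: (1) $\mathfrak{fr}(\mathcal{F})=\mathfrak{no}(\mathcal{F})=0$ if and only if $\mathcal{F}$ is linearly ordered by inclusion; (2) $\mathfrak{fr}(\mathcal{F})=\mathfrak{no}(\mathcal{F})=3$ if and only if $\mathcal{F}$ is the family of all subsets of $X$; (3) $\mathfrak{fr}(\mathcal{F})=\mathfrak{no}(\mathcal{F})=2$ if and only if $\mathcal{F}$ is not the family of all subsets of $X$ and $\mathcal{F}$ contains a cycle; (4) $\mathfrak{fr}(\mathcal{F})=\mathfrak{no}(\mathcal{F})=1$ in the remaining cases.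
   Context: For a set $Z$, $[Z]^{<\omega}$ denotes the family of all finite subsets of $Z$. The cardinal $\aleph_n$ is identified with the set of all ordinals below the initial ordinal $\omega_n$. For a finite family $\mathcal{F}$ of finite sets, $\mathfrak{fr}(\mathcal{F})$ is the least natural number $n\geq 0$ such that for every function $S:[\aleph_n]^{<\omega}\to[\aleph_n]^{<\omega}$ there exist $Y\subset\aleph_n$ and a bijection $u:\bigcup\mathcal{F}\to Y$ such that $S(u(A))\cap Y\subset u(A)$ for all $A\in\mathcal{F}$, where $u(A)=\{u(a):a\in A\}$ (such an $n$ always exists). A family $\mathfrak{S}$ of finite sequences of elements of a set $X$ is a nested-orders family on $X$ if: (i) $(t)\in\mathfrak{S}$ for all $t\in X$; (ii) if $(t_1,\ldots,t_k)\in\mathfrak{S}$ then $t_i\neq t_j$ for $i\neq j$; (iii) if $k\geq 2$ and $(t_1,\ldots,t_k)\in\mathfrak{S}$, then $(t_1,\ldots,t_{k-1})\in\mathfrak{S}$ and $(t_1,\ldots,t_{k-2},t_k)\in\mathfrak{S}$; (iv) for $k\geq 0$, if $(t_1,\ldots,t_k,s,t)\in\mathfrak{S}$ and $(t_1,\ldots,t_k,t,u)\in\mathfrak{S}$, then $(t_1,\ldots,t_k,s,u)\in\mathfrak{S}$; (v) for $k\geq 0$, if $(t_1,\ldots,t_k,t)\in\mathfrak{S}$, $(t_1,\ldots,t_k,s)\in\mathfrak{S}$ and $t\neq s$, then $(t_1,\ldots,t_k,t,s)\in\mathfrak{S}$ or $(t_1,\ldots,t_k,s,t)\in\mathfrak{S}$.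 For $n\geq 0$, $\mathcal{F}_{\mathfrak{S},n}$ is the family of all $A\subset X$ such that whenever $(t_1,\ldots,t_{n+2})\in\mathfrak{S}$ and $t_1,\ldots,t_{n+1}\in A$, then $t_{n+2}\in A$. For a family $\mathcal{F}$ of subsets of a finite set $X$, $\mathfrak{no}(\mathcal{F})$ is the least $n\geq 0$ such that there is a nested-orders family $\mathfrak{S}$ on $X$ with $\mathcal{F}\subset\mathcal{F}_{\mathfrak{S},n}$. A family $\mathcal{F}$ of subsets of $X$ contains a cycle if there is a set $A=\{x_1,\ldots,x_k\}\subset X$, with $k\geq 3$ and $x_1,\ldots,x_k$ distinct, such that $\{x_1,x_2\},\{x_2,x_3\},\ldots,\{x_{k-1},x_k\},\{x_k,x_1\}$ all belong to $\mathcal{F}|_A=\{B\cap A : B\in\mathcal{F}\}$. *)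

theory Defs
  imports Main
begin

unbundle cardinal_syntax

text \<open>
  Only the cardinality of \<open>\<aleph>\<^sub>n\<close> matters below, so the set of ordinals below \<open>\<omega>\<^sub>n\<close> is represented by
  an arbitrary set of that cardinality (see \<open>free_at_cong\<close>). As \<open>|W| <o cardSuc |W|\<close>, the witness
  \<open>W\<close> can always be chosen in the same type as \<open>Z\<close>.
\<close>

primrec is_aleph :: "nat \<Rightarrow> 'u set \<Rightarrow> bool" where
  "is_aleph 0 Z \<longleftrightarrow> |Z| =o natLeq"
| "is_aleph (Suc n) Z \<longleftrightarrow> (\<exists>W::'u set. is_aleph n W \<and> |Z| =o cardSuc |W| )"

definition free_at :: "'u set \<Rightarrow> 'a set set \<Rightarrow> bool" where
  "free_at Z \<F> \<longleftrightarrow>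
    (\<forall>S :: 'u set \<Rightarrow> 'u set.
       (\<forall>B. B \<subseteq> Z \<and> finite B \<longrightarrow> S B \<subseteq> Z \<and> finite (S B)) \<longrightarrow>
       (\<exists>Y u. Y \<subseteq> Z \<and> bij_betw u (\<Union>\<F>) Y \<and> (\<forall>A\<in>\<F>. S (u ` A) \<inter> Y \<subseteq> u ` A)))"

text \<open>
  No single HOL type provably contains sets of all the cardinalities \<open>\<aleph>\<^sub>n\<close>, so the type \<open>'u\<close> in which
  the \<open>\<aleph>\<^sub>n\<close> are taken is a parameter. The value is the least \<open>n\<close> demanded by the mathematical
  definition whenever \<open>'u\<close> is large enough to contain a set of cardinality \<open>\<aleph>\<^sub>n\<close> for that \<open>n\<close>.
\<close>

definition fr :: "'u itself \<Rightarrow> 'a set set \<Rightarrow> nat" where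
  "fr U \<F> = (LEAST n. \<exists>Z :: 'u set. is_aleph n Z \<and> free_at Z \<F>)"

text \<open>A sequence \<open>(t\<^sub>1, \<dots>, t\<^sub>k)\<close> is the list \<open>[t\<^sub>1, \<dots>, t\<^sub>k]\<close>.\<close>

definition nested_orders :: "'a set \<Rightarrow> 'a list set \<Rightarrow> bool" where
  "nested_orders X \<SS> \<longleftrightarrow>
     \<SS> \<subseteq> lists X \<and>
     (\<forall>t\<in>X. [t] \<in> \<SS>) \<and>
     (\<forall>ts\<in>\<SS>. distinct ts) \<and>
     (\<forall>ts s t. ts @ [s, t] \<in> \<SS> \<longrightarrow> ts @ [s] \<in> \<SS> \<and> ts @ [t] \<in> \<SS>) \<and>
     (\<forall>ts s t u. ts @ [s, t] \<in> \<SS> \<and> ts @ [t, u] \<in> \<SS> \<longrightarrow> ts @ [s, u] \<in> \<SS>) \<and>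
     (\<forall>ts s t. ts @ [t] \<in> \<SS> \<and> ts @ [s] \<in> \<SS> \<and> t \<noteq> s \<longrightarrow>
        ts @ [t, s] \<in> \<SS> \<or> ts @ [s, t] \<in> \<SS>)"

definition closed_sets :: "'a set \<Rightarrow> 'a list set \<Rightarrow> nat \<Rightarrow> 'a set set" where
  "closed_sets X \<SS> n =
     {A. A \<subseteq> X \<and> (\<forall>ts t. ts @ [t] \<in> \<SS> \<and> length ts = n + 1 \<and> set ts \<subseteq> A \<longrightarrow> t \<in> A)}"

definition no :: "'a set \<Rightarrow> 'a set set \<Rightarrow> nat" where
  "no X \<F> = (LEAST n. \<exists>\<SS>. nested_orders X \<SS> \<and> \<F> \<subseteq> closed_sets X \<SS> n)"

definition contains_cycle :: "'a set \<Rightarrow> 'a set set \<Rightarrow> bool" where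
  "contains_cycle X \<F> \<longleftrightarrow>
     (\<exists>xs. set xs \<subseteq> X \<and> 3 \<le> length xs \<and> distinct xs \<and>
        (\<forall>i<length xs. {xs ! i, xs ! (Suc i mod length xs)} \<in> (\<lambda>B. B \<inter> set xs) ` \<F>))"

definition intersection_closed :: "'a set \<Rightarrow> 'a set set \<Rightarrow> bool" where
  "intersection_closed X \<F> \<longleftrightarrow> (\<forall>\<G>. \<G> \<subseteq> \<F> \<longrightarrow> X \<inter> \<Inter>\<G> \<in> \<F>)"

definition linearly_ordered :: "'a set set \<Rightarrow> bool" where
  "linearly_ordered \<F> \<longleftrightarrow> (\<forall>A\<in>\<F>. \<forall>B\<in>\<F>. A \<subseteq> B \<or> B \<subseteq> A)"


text \<open>Independence of the representation of \<open>\<aleph>\<^sub>n\<close>, and existence of large enough types.\<close>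

lemma cardSuc_card_of_cong: "|A| =o |B| \<Longrightarrow> cardSuc |A| =o cardSuc |B|"
  by (rule cardSuc_invar_ordIso[THEN iffD2, OF card_of_Card_order card_of_Card_order])

lemma is_aleph_ordIso:
  fixes Z :: "'u set" and Z' :: "'v set"
  assumes "is_aleph n Z" "is_aleph n Z'"
  shows "|Z| =o |Z'|"
  using assms
proof (induction n arbitrary: Z Z')
  case 0
  then show ?case by (auto intro: ordIso_transitive ordIso_symmetric)
next
  case (Suc n)
  then obtain W :: "'u set" and W' :: "'v set" where
    W: "is_aleph n W" "|Z| =o cardSuc |W|" and W': "is_aleph n W'" "|Z'| =o cardSuc |W'|"
    by auto
  have "cardSuc |W| =o cardSuc |W'|"
    by (rule cardSuc_card_of_cong[OF Suc.IH[OF W(1) W'(1)]])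
  then show ?case
    by (rule ordIso_transitive[OF W(2) ordIso_transitive[OF _ ordIso_symmetric[OF W'(2)]]])
qed

lemma free_at_bij:
  assumes f: "bij_betw f Z Z'" and fr: "free_at Z \<F>"
  shows "free_at Z' \<F>"
  unfolding free_at_def
proof (intro allI impI)
  fix S :: "'b set \<Rightarrow> 'b set"
  assume S: "\<forall>B. B \<subseteq> Z' \<and> finite B \<longrightarrow> S B \<subseteq> Z' \<and> finite (S B)"
  define g where "g = the_inv_into Z f"
  have inj: "inj_on f Z" and im: "f ` Z = Z'" using f by (auto simp: bij_betw_def)
  have g: "g (f z) = z" if "z \<in> Z" for z
    using that inj by (simp add: g_def the_inv_into_f_f)
  have gZ: "g y \<in> Z" if "y \<in> Z'" for y
    using that im g by auto
  define T where "T = (\<lambda>B. g ` S (f ` B))"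
  have "\<forall>B. B \<subseteq> Z \<and> finite B \<longrightarrow> T B \<subseteq> Z \<and> finite (T B)"
  proof (intro allI impI)
    fix B assume "B \<subseteq> Z \<and> finite B"
    then have "f ` B \<subseteq> Z' \<and> finite (f ` B)" using im by auto
    then have "S (f ` B) \<subseteq> Z' \<and> finite (S (f ` B))" using S by blast
    then show "T B \<subseteq> Z \<and> finite (T B)" unfolding T_def using gZ by auto
  qed
  from fr[unfolded free_at_def, THEN spec, THEN mp, OF this] obtain Y u where Y: "Y \<subseteq> Z" and u: "bij_betw u (\<Union>\<F>) Y"
    and free: "\<forall>A\<in>\<F>. T (u ` A) \<inter> Y \<subseteq> u ` A"
    by (elim exE conjE) (rule that)
  have "bij_betw f Y (f ` Y)" using inj_on_subset[OF inj Y] by (rule bij_betw_imageI) simp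
  then have "bij_betw (f \<circ> u) (\<Union>\<F>) (f ` Y)" by (rule bij_betw_trans[OF u])
  moreover have "\<forall>A\<in>\<F>. S ((f \<circ> u) ` A) \<inter> f ` Y \<subseteq> (f \<circ> u) ` A"
  proof (intro ballI subsetI)
    fix A x assume A: "A \<in> \<F>" and x: "x \<in> S ((f \<circ> u) ` A) \<inter> f ` Y"
    then obtain y where y: "y \<in> Y" "x = f y" by auto
    have "y = g x" using y Y g by auto
    moreover have "x \<in> S (f ` u ` A)" using x by (simp add: image_comp)
    ultimately have "y \<in> T (u ` A)" unfolding T_def by blast
    then have "y \<in> u ` A" using free A y by blast
    then show "x \<in> (f \<circ> u) ` A" using y by auto
  qed
  moreover have "f ` Y \<subseteq> Z'" using Y im by auto
  ultimately show "\<exists>Y u. Y \<subseteq> Z' \<and> bij_betw u (\<Union>\<F>) Y \<and> (\<forall>A\<in>\<F>. S (u ` A) \<inter> Y \<subseteq> u ` A)"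
    by (intro exI[of _ "f ` Y"] exI[of _ "f \<circ> u"] conjI)
qed

lemma free_at_cong:
  assumes "is_aleph n Z" "is_aleph n Z'"
  shows "free_at Z \<F> \<longleftrightarrow> free_at Z' \<F>"
proof
  obtain f where "bij_betw f Z Z'"
    using is_aleph_ordIso[OF assms] by (auto simp flip: card_of_ordIso)
  then show "free_at Z \<F> \<Longrightarrow> free_at Z' \<F>" by (rule free_at_bij)
next
  obtain f where "bij_betw f Z' Z"
    using is_aleph_ordIso[OF assms(2,1)] by (auto simp flip: card_of_ordIso)
  then show "free_at Z' \<F> \<Longrightarrow> free_at Z \<F>" by (rule free_at_bij)
qed

lemma is_aleph_transfer:
  fixes Z :: "'u set" and Z' :: "'v set"
  assumes "is_aleph n Z" "|Z| =o |Z'|"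
  shows "is_aleph n Z'"
  using assms
proof (induction n arbitrary: Z Z')
  case 0
  then show ?case by (auto intro: ordIso_transitive ordIso_symmetric)
next
  case (Suc n)
  then obtain W :: "'u set" where W: "is_aleph n W" "|Z| =o cardSuc |W|" by auto
  then have eq: "|Z'| =o cardSuc |W|" 
    using ordIso_transitive[OF ordIso_symmetric[OF Suc.prems(2)]] by blast
  have "|W| <o cardSuc |W|" by (rule cardSuc_greater[OF card_of_Card_order])
  then have "|W| <o |Z'|" by (rule ordLess_ordIso_trans[OF _ ordIso_symmetric[OF eq]])
  then obtain W' where W': "W' \<subseteq> Z'" "|W| =o |W'|"
    using internalize_card_of_ordLeq2[of W Z'] ordLess_imp_ordLeq[of "|W|" "|Z'|"] by blast
  have "is_aleph n W'" using Suc.IH[OF W(1) W'(2)] .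
  moreover have "|Z'| =o cardSuc |W'|"
    by (rule ordIso_transitive[OF eq cardSuc_card_of_cong[OF W'(2)]])
  ultimately show ?case by auto
qed

lemma is_aleph_Suc_set:
  assumes "is_aleph n (Z :: 'u set)"
  shows "\<exists>Z' :: 'u set set. is_aleph (Suc n) Z'"
proof -
  have "cardSuc |Z| \<le>o |Pow Z|"
    by (rule cardSuc_least[OF card_of_Card_order card_of_Card_order card_of_Pow])
  moreover have suc: "|Field (cardSuc |Z| )| =o cardSuc |Z|"
    by (rule card_of_Field_ordIso[OF cardSuc_Card_order[OF card_of_Card_order]])
  ultimately have "|Field (cardSuc |Z| )| \<le>o |Pow Z|"
    using ordIso_ordLeq_trans by blast
  then obtain Z' :: "'u set set" where eq: "|Field (cardSuc |Z| )| =o |Z'|"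
    by (blast dest: internalize_card_of_ordLeq2[THEN iffD1])
  have Z': "|Z'| =o cardSuc |Z|"
    by (rule ordIso_transitive[OF ordIso_symmetric[OF eq] suc])
  let ?i = "\<lambda>z::'u. {z}"
  have "|Z| =o |?i ` Z|" by (rule card_of_ordIsoI[of ?i]) (auto simp: bij_betw_def inj_on_def)
  then have "is_aleph n (?i ` Z)" and "|Z'| =o cardSuc |?i ` Z|"
    by (rule is_aleph_transfer[OF assms], rule ordIso_transitive[OF Z' cardSuc_card_of_cong])
  then show ?thesis by auto
qed

lemma ex_is_aleph_3: "\<exists>Z :: nat set set set set. is_aleph 3 Z"
proof -
  have "is_aleph 0 (UNIV :: nat set)" using card_of_nat by simp
  from is_aleph_Suc_set[OF this] obtain A :: "nat set set" where "is_aleph (Suc 0) A" ..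
  from is_aleph_Suc_set[OF this] obtain B :: "nat set set set" where "is_aleph (Suc (Suc 0)) B" ..
  from is_aleph_Suc_set[OF this] show ?thesis by (simp only: numeral_3_eq_3)
qed

end

theory Submission
  imports Defs "HOL-Library.Countable_Set_Type"
begin

text \<open>
  Write \<open>\<F>\<close> for a family of subsets of a four-element set \<open>X\<close>. Neither invariant changes when \<open>\<F>\<close>
  is closed under intersections, so \<open>\<F>\<close> may be taken intersection closed. The argument is then a
  circle of inequalities \<open>rank \<le> no \<le> fr \<le> rank\<close>, where \<open>rank\<close> is the number \<open>0\<close>, \<open>1\<close>, \<open>2\<close> or \<open>3\<close>
  read off from the shape of \<open>\<F>\<close> (\<open>four_point_rank\<close>).

  The inequality \<open>no \<le> fr\<close> holds for every finite ground set. By induction on \<open>n\<close>, the cardinal \<open>\<aleph>\<^sub>n\<close> carries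
  nested orders in which a sequence of length \<open>n + 1\<close> has only finitely many one-point extensions:
  well-order \<open>\<aleph>\<^sub>n\<close> so that every initial segment has size below \<open>\<aleph>\<^sub>n\<close>, and put nested orders for
  \<open>\<aleph>\<^bsub>n-1\<^esub>\<close> on each segment. Let \<open>S B\<close> collect the extensions of sequences of length \<open>n + 1\<close> taken
  from \<open>B\<close>. A copy of \<open>X\<close> that is free for this \<open>S\<close> pulls the nested orders back to nested orders on
  \<open>X\<close> for which all members of \<open>\<F>\<close> are closed (\<open>closed_sets_free_at\<close>).

  The inequality \<open>rank \<le> no\<close> is finite combinatorics. For \<open>n = 0\<close> the closed sets form a chain; for
  \<open>n = 1\<close> a cycle would contradict the comparison of the two neighbours of its greatest point; for
  \<open>n = 2\<close> four points contain a sequence of length four, whose first three terms do not form a closed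
  set.

  For \<open>fr \<le> rank\<close> free copies must be constructed. Chains are embedded greedily, and the family of
  all subsets is handled by Kuratowski's free set theorem (\<open>kuratowski\<close>). If some subset is missing, then a
  three-element set \<open>{a, b, c}\<close> is missing, and one dimension can be saved over Kuratowski
  (\<open>triple_configuration\<close>). If there is no cycle, some two points \<open>a\<close>, \<open>b\<close> are separated: no member
  of \<open>\<F>\<close> other than \<open>X\<close> contains both, and each of them is joined by a pair in \<open>\<F>\<close> to at most one of
  the other two points (\<open>acyclic_separated_pair\<close>). Hence the pairs in \<open>\<F>\<close> lie in a star or in a
  path, and in both cases an uncountable set contains a free copy (\<open>star_configuration\<close>,
  \<open>path_configuration\<close>).
\<close>

section \<open>Free embeddings\<close>

definition set_mapping :: "'u set \<Rightarrow> ('u set \<Rightarrow> 'u set) \<Rightarrow> bool" where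
  "set_mapping Z S \<longleftrightarrow> (\<forall>B. B \<subseteq> Z \<and> finite B \<longrightarrow> S B \<subseteq> Z \<and> finite (S B))"

text \<open>
  For an inflationary map, \<open>u x \<notin> S (u ` B)\<close> implies the same for all \<open>A \<subseteq> B\<close>, and also
  \<open>u x \<notin> u ` B\<close>; so freeness needs checking only on large sets \<open>B\<close>.
\<close>

definition inflationary :: "('u set \<Rightarrow> 'u set) \<Rightarrow> bool" where
  "inflationary S \<longleftrightarrow> mono S \<and> (\<forall>B. B \<subseteq> S B)"

text \<open>
  In \<open>free_at\<close> the set \<open>Y\<close> is the image of \<open>u\<close>, so freeness can be said about \<open>u\<close> alone, point by point.
\<close>

definition free_embedding :: "'u set \<Rightarrow> ('u set \<Rightarrow> 'u set) \<Rightarrow> 'a set set \<Rightarrow> ('a \<Rightarrow> 'u) \<Rightarrow> bool" where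
  "free_embedding Z S \<F> u \<longleftrightarrow> inj_on u (\<Union>\<F>) \<and> u ` \<Union>\<F> \<subseteq> Z \<and>
     (\<forall>A\<in>\<F>. \<forall>x\<in>\<Union>\<F> - A. u x \<notin> S (u ` A))"

lemma inflationary_mono: "inflationary S \<Longrightarrow> B \<subseteq> C \<Longrightarrow> S B \<subseteq> S C"
  by (auto simp: inflationary_def dest: monoD)

lemma inflationary_upper: "inflationary S \<Longrightarrow> B \<subseteq> S B"
  by (simp add: inflationary_def)

lemma set_mappingD:
  assumes "set_mapping Z S" "B \<subseteq> Z" "finite B"
  shows "S B \<subseteq> Z" "finite (S B)"
  using assms by (auto simp: set_mapping_def)

lemma free_embeddingI:
  assumes "inj_on u (\<Union>\<F>)" "\<And>x. x \<in> \<Union>\<F> \<Longrightarrow> u x \<in> Z"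
    and "\<And>A x. A \<in> \<F> \<Longrightarrow> x \<in> \<Union>\<F> \<Longrightarrow> x \<notin> A \<Longrightarrow> u x \<notin> S (u ` A)"
  shows "free_embedding Z S \<F> u"
  using assms by (auto simp: free_embedding_def)

lemma free_embeddingD:
  assumes "free_embedding Z S \<F> u"
  shows "inj_on u (\<Union>\<F>)" "x \<in> \<Union>\<F> \<Longrightarrow> u x \<in> Z"
    "A \<in> \<F> \<Longrightarrow> x \<in> \<Union>\<F> \<Longrightarrow> x \<notin> A \<Longrightarrow> u x \<notin> S (u ` A)"
  using assms by (auto simp: free_embedding_def)

lemma free_at_iff_free_embedding:
  "free_at Z \<F> \<longleftrightarrow> (\<forall>S. set_mapping Z S \<longrightarrow> (\<exists>u. free_embedding Z S \<F> u))"
proof -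
  have "(\<exists>Y u. Y \<subseteq> Z \<and> bij_betw u (\<Union>\<F>) Y \<and> (\<forall>A\<in>\<F>. S (u ` A) \<inter> Y \<subseteq> u ` A)) \<longleftrightarrow>
      (\<exists>u. free_embedding Z S \<F> u)" for S
  proof (intro iffI; elim exE conjE)
    fix Y u assume "Y \<subseteq> Z" and u: "bij_betw u (\<Union>\<F>) Y" and fr: "\<forall>A\<in>\<F>. S (u ` A) \<inter> Y \<subseteq> u ` A"
    have "u x \<notin> S (u ` A)" if "A \<in> \<F>" "x \<in> \<Union>\<F>" "x \<notin> A" for A x
    proof
      assume "u x \<in> S (u ` A)"
      moreover have "u x \<in> Y" using u that(2) by (auto simp: bij_betw_def)
      ultimately have "u x \<in> u ` A" using fr that(1) by blast
      then obtain a where "a \<in> A" "u x = u a" by blast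
      then show False using u that by (metis UnionI bij_betw_def inj_onD)
    qed
    then show "\<exists>u. free_embedding Z S \<F> u"
      using u \<open>Y \<subseteq> Z\<close> by (auto simp: free_embedding_def bij_betw_def)
  next
    fix u assume "free_embedding Z S \<F> u"
    then show "\<exists>Y u. Y \<subseteq> Z \<and> bij_betw u (\<Union>\<F>) Y \<and> (\<forall>A\<in>\<F>. S (u ` A) \<inter> Y \<subseteq> u ` A)"
      unfolding free_embedding_def
      by (intro exI[of _ "u ` \<Union>\<F>"] exI[of _ u]) (simp add: bij_betw_def, blast)
  qed
  then show ?thesis by (simp add: free_at_def set_mapping_def)
qed

lemma free_at_subset:
  assumes "free_at Z \<G>" "\<F> \<subseteq> \<G>"
  shows "free_at Z \<F>"
  using assms
  unfolding free_at_iff_free_embedding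
proof (intro allI impI)
  fix S :: "'a set \<Rightarrow> 'a set"
  assume "\<forall>S. set_mapping Z S \<longrightarrow> (\<exists>u. free_embedding Z S \<G> u)" "\<F> \<subseteq> \<G>" "set_mapping Z S"
  then obtain u where u: "free_embedding Z S \<G> u" "\<F> \<subseteq> \<G>" by blast
  have sub: "\<Union>\<F> \<subseteq> \<Union>\<G>" using u(2) by (rule Union_mono)
  have "free_embedding Z S \<F> u"
  proof (rule free_embeddingI)
    show "inj_on u (\<Union>\<F>)" using free_embeddingD(1)[OF u(1)] sub by (rule inj_on_subset)
  next
    fix x assume "x \<in> \<Union>\<F>"
    then show "u x \<in> Z" using free_embeddingD(2)[OF u(1)] sub by blast
  next
    fix A x assume "A \<in> \<F>" "x \<in> \<Union>\<F>" "x \<notin> A"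
    then show "u x \<notin> S (u ` A)" using free_embeddingD(3)[OF u(1)] sub u(2) by blast
  qed
  then show "\<exists>u. free_embedding Z S \<F> u" by blast
qed

definition inflate :: "('u set \<Rightarrow> 'u set) \<Rightarrow> 'u set \<Rightarrow> 'u set" where
  "inflate S B = B \<union> (\<Union>C\<in>Pow B. S C)"

lemma inflationary_inflate: "inflationary (inflate S)"
  by (fastforce simp: inflationary_def inflate_def mono_def)

lemma inflate_upper: "C \<subseteq> B \<Longrightarrow> S C \<subseteq> inflate S B"
  by (auto simp: inflate_def)

lemma set_mapping_inflate: "set_mapping Z S \<Longrightarrow> set_mapping Z (inflate S)"
  unfolding set_mapping_def
proof (intro allI impI conjI)
  fix B assume S: "\<forall>B. B \<subseteq> Z \<and> finite B \<longrightarrow> S B \<subseteq> Z \<and> finite (S B)" and B: "B \<subseteq> Z \<and> finite B"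
  then have "S C \<subseteq> Z" "finite (S C)" if "C \<subseteq> B" for C
    using that by (meson finite_subset subset_trans)+
  then show "inflate S B \<subseteq> Z" "finite (inflate S B)"
    using B by (auto simp: inflate_def)
qed

text \<open>
  The inflationary map \<open>inflate S\<close> still has finite values and dominates \<open>S\<close>, so an embedding that
  is free for it is free for \<open>S\<close>.
\<close>

lemma free_atI:
  assumes "\<And>S. set_mapping Z S \<Longrightarrow> inflationary S \<Longrightarrow> \<exists>u. free_embedding Z S \<F> u"
  shows "free_at Z \<F>"
  unfolding free_at_iff_free_embedding
proof (intro allI impI)
  fix S assume "set_mapping Z S"
  then obtain u where u: "free_embedding Z (inflate S) \<F> u"
    using assms inflationary_inflate set_mapping_inflate by blast
  have "u x \<notin> S (u ` A)" if "A \<in> \<F>" "x \<in> \<Union>\<F>" "x \<notin> A" for A x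
    using free_embeddingD(3)[OF u that] inflate_upper[of "u ` A" "u ` A" S] by blast
  then have "free_embedding Z S \<F> u"
    using free_embeddingD(1,2)[OF u] by (intro free_embeddingI)
  then show "\<exists>u. free_embedding Z S \<F> u" by blast
qed

section \<open>Closure under intersections\<close>

definition intersection_closure :: "'a set \<Rightarrow> 'a set set \<Rightarrow> 'a set set" where
  "intersection_closure X \<F> = (\<lambda>\<H>. X \<inter> \<Inter>\<H>) ` Pow \<F>"

lemma intersection_closure_subset: "intersection_closure X \<F> \<subseteq> Pow X"
  by (auto simp: intersection_closure_def)

lemma subset_intersection_closure: "\<F> \<subseteq> Pow X \<Longrightarrow> \<F> \<subseteq> intersection_closure X \<F>"
  unfolding intersection_closure_def by (auto intro!: image_eqI[of _ _ "{A}" for A])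

lemma intersection_closed_closure: "intersection_closed X (intersection_closure X \<F>)"
  unfolding intersection_closed_def
proof (intro allI impI)
  fix \<G> assume G: "\<G> \<subseteq> intersection_closure X \<F>"
  then obtain \<K> where K: "\<K> \<subseteq> Pow \<F>" "\<G> = (\<lambda>\<H>. X \<inter> \<Inter>\<H>) ` \<K>"
    unfolding intersection_closure_def by (meson subset_imageE)
  have "X \<inter> \<Inter>\<G> = X \<inter> \<Inter>(\<Union>\<K>)"
    unfolding K(2) by blast
  moreover have "\<Union>\<K> \<in> Pow \<F>" using K(1) by blast
  ultimately show "X \<inter> \<Inter>\<G> \<in> intersection_closure X \<F>"
    unfolding intersection_closure_def by blast
qed

text \<open>
  If \<open>A\<close> is an intersection of members of \<open>\<F>\<close> and \<open>x \<notin> A\<close>, some member \<open>B \<supseteq> A\<close> omits \<open>x\<close>, and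
  monotonicity bounds \<open>S (u ` A)\<close> by \<open>S (u ` B)\<close>. The points of \<open>X\<close> outside \<open>\<Union>\<F>\<close> have no image
  yet; as \<open>\<F>\<close> is finite they can be sent outside all the finite sets \<open>S (u ` B)\<close>.
\<close>

lemma free_at_intersection_closure:
  assumes Z: "infinite Z" and X: "finite X" and F: "\<F> \<subseteq> Pow X" and fr: "free_at Z \<F>"
  shows "free_at Z (intersection_closure X \<F>)"
proof (rule free_atI)
  fix S assume S: "set_mapping Z S" "inflationary S"
  obtain u where u: "free_embedding Z S \<F> u" using fr S(1) free_at_iff_free_embedding by blast
  let ?U = "\<Union>\<F>"
  define N where "N = u ` ?U \<union> (\<Union>A\<in>\<F>. S (u ` A))"
  have finF: "finite \<F>" and finU: "finite ?U" and UX: "?U \<subseteq> X"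
    using X F by (auto intro: finite_subset[of \<F> "Pow X"] finite_subset[of ?U X])
  have "finite (S (u ` A))" if "A \<in> \<F>" for A
  proof (rule set_mappingD(2)[OF S(1)])
    show "u ` A \<subseteq> Z" using that free_embeddingD(2)[OF u] by blast
    show "finite (u ` A)" using that finU by (meson Union_upper finite_imageI finite_subset)
  qed
  then have "finite N" using finF finU by (auto simp: N_def)
  then have "infinite (Z - N)" using Z by simp
  then obtain P where P: "P \<subseteq> Z - N" "finite P" "card P = card (X - ?U)"
    using infinite_arbitrarily_large by metis
  then obtain v where v: "bij_betw v (X - ?U) P"
    using X by (metis finite_Diff finite_same_card_bij)
  define w where "w x = (if x \<in> ?U then u x else v x)" for x
  have wv: "w x \<in> Z - N" if "x \<in> X" "x \<notin> ?U" for x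
    using that v P by (auto simp: w_def bij_betw_def)
  have w_img: "w ` A = u ` A" if "A \<in> \<F>" for A
    using that by (auto simp: w_def)
  have inj: "inj_on w X"
  proof (rule inj_onI)
    fix x y assume xy: "x \<in> X" "y \<in> X" "w x = w y"
    have "w z \<in> N \<longleftrightarrow> z \<in> ?U" if "z \<in> X" for z
      using that wv[of z] by (cases "z \<in> ?U") (auto simp: w_def N_def)
    then have "x \<in> ?U \<longleftrightarrow> y \<in> ?U" using xy by metis
    with xy consider "x \<in> ?U" "y \<in> ?U" "u x = u y" | "x \<in> X - ?U" "y \<in> X - ?U" "v x = v y"
      unfolding w_def by (cases "x \<in> ?U") auto
    then show "x = y"
      using free_embeddingD(1)[OF u] v by cases (auto simp: bij_betw_def dest: inj_onD)
  qed
  have sep: "w x \<notin> S (w ` A)" if A: "A \<in> \<F>" and x: "x \<in> X - A" for A x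
  proof (cases "x \<in> ?U")
    case True
    then show ?thesis using free_embeddingD(3)[OF u A True] x w_img[OF A] by (simp add: w_def)
  next
    case False
    then have "w x \<in> Z - N" using x by (intro wv) simp_all
    then show ?thesis using A w_img[OF A] by (auto simp: N_def)
  qed
  have "free_embedding Z S (intersection_closure X \<F>) w"
  proof (rule free_embeddingI)
    have sub: "\<Union>(intersection_closure X \<F>) \<subseteq> X" by (auto simp: intersection_closure_def)
    show "inj_on w (\<Union>(intersection_closure X \<F>))" using inj sub by (rule inj_on_subset)
    have "w x \<in> Z" if "x \<in> X" for x
      using that wv[of x] free_embeddingD(2)[OF u, of x] by (cases "x \<in> ?U") (simp_all add: w_def)
    then show "w x \<in> Z" if "x \<in> \<Union>(intersection_closure X \<F>)" for x using that sub by blast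
    fix A x assume A: "A \<in> intersection_closure X \<F>"
      and x: "x \<in> \<Union>(intersection_closure X \<F>)" "x \<notin> A"
    then obtain \<H> where H: "\<H> \<subseteq> \<F>" "A = X \<inter> \<Inter>\<H>" using A by (auto simp: intersection_closure_def)
    then obtain B where B: "B \<in> \<H>" "x \<notin> B" using x sub by blast
    have "S (w ` A) \<subseteq> S (w ` B)"
      using B H by (intro inflationary_mono[OF S(2)] image_mono) blast
    moreover have "w x \<notin> S (w ` B)" using sep B H x sub by blast
    ultimately show "w x \<notin> S (w ` A)" by blast
  qed
  then show "\<exists>u. free_embedding Z S (intersection_closure X \<F>) u" by blast
qed

text \<open>
  Remove the greatest member \<open>M\<close> of the chain. It comes back as the empty intersection in the
  closure of the remaining family within \<open>M\<close>.
\<close>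

lemma free_at_linearly_ordered:
  assumes Z: "infinite Z" and "finite \<F>" "\<forall>A\<in>\<F>. finite A" "linearly_ordered \<F>"
  shows "free_at Z \<F>"
  using assms(2-)
proof (induction \<F> rule: finite_psubset_induct)
  case (psubset \<F>)
  show ?case
  proof (cases "\<F> = {}")
    case True
    then show ?thesis by (auto simp: free_at_iff_free_embedding free_embedding_def)
  next
    case False
    then obtain M where M: "M \<in> \<F>" "\<forall>A\<in>\<F>. M \<subseteq> A \<longrightarrow> M = A"
      using finite_has_maximal[OF psubset.hyps(1)] by auto
    then have top: "\<F> \<subseteq> Pow M" using psubset.prems(2) unfolding linearly_ordered_def by blast
    let ?\<F>' = "\<F> - {M}"
    have "free_at Z ?\<F>'"
      using psubset.prems M(1) by (intro psubset.IH) (auto simp: linearly_ordered_def)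
    then have "free_at Z (intersection_closure M ?\<F>')"
      using Z psubset.prems(1) M(1) top by (intro free_at_intersection_closure) auto
    moreover have "\<F> \<subseteq> intersection_closure M ?\<F>'"
    proof
      fix A assume "A \<in> \<F>"
      show "A \<in> intersection_closure M ?\<F>'"
      proof (cases "A = M")
        case True
        then show ?thesis unfolding intersection_closure_def by (auto intro!: image_eqI[of _ _ "{}"])
      next
        case False
        then show ?thesis using subset_intersection_closure[of ?\<F>' M] top \<open>A \<in> \<F>\<close> by blast
      qed
    qed
    ultimately show ?thesis by (rule free_at_subset)
  qed
qed

section \<open>Kuratowski's free set theorem\<close>

lemma is_aleph_infinite: "is_aleph n Z \<Longrightarrow> infinite Z"
proof (induction n arbitrary: Z)
  case 0
  then show ?case using infinite_iff_natLeq_ordLeq ordIso_iff_ordLeq by auto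
next
  case (Suc n)
  then obtain W :: "'a set" where W: "is_aleph n W" "|Z| =o cardSuc |W|" by auto
  then have "|W| <o |Z|"
    using ordLess_ordIso_trans[OF cardSuc_greater[OF card_of_Card_order]] ordIso_symmetric by blast
  then show ?case using Suc.IH[OF W(1)] card_of_ordLeq_finite ordLess_imp_ordLeq by blast
qed

lemma is_aleph_Suc_subset:
  assumes "is_aleph (Suc n) Z"
  obtains W where "W \<subseteq> Z" "is_aleph n W" "|W| <o |Z|"
proof -
  obtain W :: "'a set" where W: "is_aleph n W" "|Z| =o cardSuc |W|" using assms by auto
  then have less: "|W| <o |Z|"
    using ordLess_ordIso_trans[OF cardSuc_greater[OF card_of_Card_order]] ordIso_symmetric by blast
  then obtain W' where W': "W' \<subseteq> Z" "|W| =o |W'|"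
    using internalize_card_of_ordLeq2[of W Z] ordLess_imp_ordLeq by blast
  show ?thesis
    using that[OF W'(1) is_aleph_transfer[OF W(1) W'(2)]] ordIso_ordLess_trans[OF _ less] W'(2)
      ordIso_symmetric by blast
qed

lemma is_aleph_downward: "is_aleph n Z \<Longrightarrow> m \<le> n \<Longrightarrow> \<exists>W\<subseteq>Z. is_aleph m W"
proof (induction n arbitrary: Z)
  case 0
  then show ?case by blast
next
  case (Suc n)
  show ?case
  proof (cases "m = Suc n")
    case True
    then show ?thesis using Suc.prems by blast
  next
    case False
    then show ?thesis
      using Suc.IH Suc.prems by (meson is_aleph_Suc_subset le_SucE subset_trans)
  qed
qed

lemma is_aleph_0_countable: "is_aleph 0 Z \<Longrightarrow> countable Z"
  by (simp add: countable_card_le_natLeq ordIso_iff_ordLeq)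

lemma not_ordLeq_card: "\<not> |A| \<le>o |B| \<longleftrightarrow> |B| <o |A|"
  by (rule not_ordLeq_iff_ordLess[OF card_of_Well_order card_of_Well_order])

lemma countable_ordLess:
  assumes "countable A" "uncountable B"
  shows "|A| <o |B|"
proof -
  have "natLeq <o |B|"
    using assms(2) not_ordLeq_iff_ordLess[OF natLeq_Well_order card_of_Well_order[of B]]
    by (simp add: countable_card_le_natLeq)
  with assms(1) show ?thesis unfolding countable_card_le_natLeq by (rule ordLeq_ordLess_trans)
qed

lemma is_aleph_Suc_uncountable:
  assumes "is_aleph (Suc n) Z"
  shows "uncountable Z"
proof
  assume Z: "countable Z"
  obtain W where W: "W \<subseteq> Z" "is_aleph n W" "|W| <o |Z|" using is_aleph_Suc_subset[OF assms] .
  have "|UNIV :: nat set| \<le>o |W|"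
    using is_aleph_infinite[OF W(2)] by (simp only: infinite_iff_card_of_nat)
  then have "|Z| \<le>o |W|"
    using Z unfolding countable_card_of_nat by (rule ordLeq_transitive[rotated])
  then show False using W(3) not_ordLess_ordLeq by blast
qed

lemma exists_outside:
  assumes "|A| <o |Z|"
  obtains z where "z \<in> Z" "z \<notin> A"
  using assms card_of_mono1[of Z A] not_ordLess_ordLeq by blast

text \<open>
  A subset \<open>P\<close> of \<open>Q\<close> of the size of \<open>W\<close> separates the two requirements: \<open>x\<close> escapes all the sets \<open>E q\<close> with
  \<open>q \<in> P\<close> because \<open>Q\<close> is larger than \<open>P\<close>, and then \<open>y \<in> P\<close> escapes the single set \<open>E x\<close>
  because \<open>P\<close> is larger than that.
\<close>

lemma free_pair:
  assumes W: "infinite W" "|W| <o |Q|" and E: "\<And>q. q \<in> Q \<Longrightarrow> |E q| <o |W|"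
  obtains x y where "x \<in> Q" "y \<in> Q" "x \<notin> E y" "y \<notin> E x"
proof -
  obtain P where P: "P \<subseteq> Q" "|W| =o |P|"
    using internalize_card_of_ordLeq2[of W Q] ordLess_imp_ordLeq[OF W(2)] by blast
  have "|\<Union>q\<in>P. E q| \<le>o |W|"
    using P E by (intro card_of_UNION_ordLeq_infinite[OF W(1)])
      (auto simp: ordIso_iff_ordLeq intro: ordLess_imp_ordLeq)
  then have "|\<Union>q\<in>P. E q| <o |Q|" using W(2) by (rule ordLeq_ordLess_trans)
  then obtain x where x: "x \<in> Q" "x \<notin> (\<Union>q\<in>P. E q)" by (rule exists_outside)
  have "|E x| <o |P|" using E[OF x(1)] P(2) by (rule ordLess_ordIso_trans)
  then obtain y where "y \<in> P" "y \<notin> E x" by (rule exists_outside)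
  then show thesis using that[of x y] x P(1) by blast
qed

lemma large_fibre:
  assumes W: "infinite W" "|W| <o |Z|" and I: "|I| \<le>o |W|" "f ` Z \<subseteq> I"
  obtains i where "i \<in> I" "|W| <o |{z \<in> Z. f z = i}|"
proof (rule ccontr)
  assume "\<not> thesis"
  then have "\<forall>i\<in>I. |{z \<in> Z. f z = i}| \<le>o |W|" using that not_ordLeq_card by blast
  then have "|\<Union>i\<in>I. {z \<in> Z. f z = i}| \<le>o |W|"
    by (rule card_of_UNION_ordLeq_infinite[OF W(1) I(1)])
  moreover have "(\<Union>i\<in>I. {z \<in> Z. f z = i}) = Z" using I(2) by blast
  ultimately show False using W(2) not_ordLess_ordLeq by auto
qed

text \<open>
  An infinite set has no more finite subsets than elements; adding the elements of a subset one at a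
  time turns the union into countably many iterated unions over \<open>W\<close>.
\<close>

lemma card_UN_finite_subsets:
  assumes W: "infinite W" and S: "\<And>B. B \<subseteq> W \<Longrightarrow> finite B \<Longrightarrow> |S B| \<le>o |W|"
  shows "|\<Union>B\<in>{B. B \<subseteq> W \<and> finite B}. S B| \<le>o |W|"
proof -
  let ?L = "\<lambda>k. {B. B \<subseteq> W \<and> finite B \<and> card B = k}"
  have level: "|\<Union>B\<in>?L k. T B| \<le>o |W|"
    if "\<And>B. B \<subseteq> W \<Longrightarrow> finite B \<Longrightarrow> |T B| \<le>o |W|" for k and T :: "'a set \<Rightarrow> 'b set"
    using that
  proof (induction k arbitrary: T)
    case 0
    have "?L 0 = {{}}" by auto
    then show ?case using 0 by simp
  next
    case (Suc k)
    have "|\<Union>w\<in>W. \<Union>B\<in>?L k. T (insert w B)| \<le>o |W|"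
    proof (rule card_of_UNION_ordLeq_infinite[OF W card_of_mono1[OF subset_refl]], rule ballI)
      fix w assume w: "w \<in> W"
      show "|\<Union>B\<in>?L k. T (insert w B)| \<le>o |W|" 
        by (rule Suc.IH, rule Suc.prems) (use w in auto)
    qed
    moreover have "(\<Union>B\<in>?L (Suc k). T B) \<subseteq> (\<Union>w\<in>W. \<Union>B\<in>?L k. T (insert w B))"
    proof
      fix x assume "x \<in> (\<Union>B\<in>?L (Suc k). T B)"
      then obtain B where B: "B \<subseteq> W" "finite B" "card B = Suc k" "x \<in> T B" by blast
      then obtain w B' where w: "B = insert w B'" "w \<notin> B'" "card B' = k" by (auto simp: card_Suc_eq)
      then have "w \<in> W" "B' \<in> ?L k" using B(1,2) by auto
      then show "x \<in> (\<Union>w\<in>W. \<Union>B\<in>?L k. T (insert w B))" using B(4) w(1) by blast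
    qed
    ultimately show ?case by (rule ordLeq_transitive[OF card_of_mono1, rotated])
  qed
  have "|\<Union>k\<in>UNIV. \<Union>B\<in>?L k. S B| \<le>o |W|"
  proof (rule card_of_UNION_ordLeq_infinite[OF W], use W infinite_iff_card_of_nat in blast, rule ballI)
    show "|\<Union>B\<in>?L k. S B| \<le>o |W|" for k using S by (rule level)
  qed
  moreover have "(\<Union>B\<in>{B. B \<subseteq> W \<and> finite B}. S B) \<subseteq> (\<Union>k\<in>UNIV. \<Union>B\<in>?L k. S B)" by auto
  ultimately show ?thesis by (rule ordLeq_transitive[OF card_of_mono1, rotated])
qed

lemma finite_ordLeq: "finite A \<Longrightarrow> infinite W \<Longrightarrow> |A| \<le>o |W|"
  by (simp add: ordLess_imp_ordLeq finite_ordLess_infinite[OF card_of_Well_order card_of_Well_order] Field_card_of)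

text \<open>
  Inside \<open>Z\<close> of size \<open>\<aleph>\<^bsub>n+1\<^esub>\<close> take \<open>W\<close> of size \<open>\<aleph>\<^sub>n\<close> and a point \<open>z\<close> that no finite subset of \<open>W\<close>
  reaches. A free set in \<open>W\<close> for \<open>B \<mapsto> S B \<union> S (insert z B)\<close> stays free for \<open>S\<close> when \<open>z\<close> is added.
\<close>

lemma kuratowski:
  assumes "is_aleph n Z" "set_mapping Z S"
  shows "\<exists>Y\<subseteq>Z. finite Y \<and> card Y = Suc n \<and> (\<forall>B\<subseteq>Y. S B \<inter> Y \<subseteq> B)"
  using assms
proof (induction n arbitrary: Z S)
  case 0
  have "infinite Z" using is_aleph_infinite 0(1) by blast
  moreover have "finite (S {})" using set_mappingD(2)[OF 0(2)] by simp
  ultimately obtain z where "z \<in> Z" "z \<notin> S {}" by (meson finite_subset subsetI)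
  then show ?case by (intro exI[of _ "{z}"]) (auto simp: subset_singleton_iff)
next
  case (Suc n)
  obtain W where W: "W \<subseteq> Z" "is_aleph n W" "|W| <o |Z|" using is_aleph_Suc_subset[OF Suc.prems(1)] .
  note inf = is_aleph_infinite[OF W(2)]
  have fin: "finite (S B)" if "B \<subseteq> Z" "finite B" for B
    using set_mappingD(2)[OF Suc.prems(2) that] .
  have "|\<Union>B\<in>{B. B \<subseteq> W \<and> finite B}. S B \<union> B| \<le>o |W|"
    using fin W(1) by (intro card_UN_finite_subsets[OF inf] finite_ordLeq[OF _ inf]) auto
  then have "|\<Union>B\<in>{B. B \<subseteq> W \<and> finite B}. S B \<union> B| <o |Z|" using W(3) by (rule ordLeq_ordLess_trans)
  then obtain z where z: "z \<in> Z" "z \<notin> (\<Union>B\<in>{B. B \<subseteq> W \<and> finite B}. S B \<union> B)"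
    by (rule exists_outside)
  then have zW: "z \<notin> W" by blast
  define T where "T B = (S B \<union> S (insert z B)) \<inter> W" for B
  have "set_mapping W T"
    unfolding set_mapping_def
  proof (intro allI impI conjI)
    fix B assume "B \<subseteq> W \<and> finite B"
    then have "B \<subseteq> Z" "insert z B \<subseteq> Z" "finite B" "finite (insert z B)" using W(1) z(1) by auto
    then have "finite (S B)" "finite (S (insert z B))" using fin by blast+
    then show "T B \<subseteq> W" "finite (T B)" by (simp_all add: T_def)
  qed
  from Suc.IH[OF W(2) this] obtain Y
    where Y: "Y \<subseteq> W" "finite Y" "card Y = Suc n" "\<forall>B\<subseteq>Y. T B \<inter> Y \<subseteq> B" by blast
  have "S B \<inter> insert z Y \<subseteq> B" if B: "B \<subseteq> insert z Y" for B
  proof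
    fix x assume x: "x \<in> S B \<inter> insert z Y"
    have C: "T (B - {z}) \<inter> Y \<subseteq> B" using Y(4) B by blast
    show "x \<in> B"
    proof (cases "x = z")
      case True
      have "z \<notin> S B" if "z \<notin> B"
        using z(2) that B Y(1,2) finite_subset[of B Y] by blast
      then show ?thesis using x True by blast
    next
      case False
      have "S B \<subseteq> S (B - {z}) \<union> S (insert z (B - {z}))"
        by (cases "z \<in> B") (simp_all add: insert_absorb)
      then have "x \<in> T (B - {z}) \<inter> Y" using x False Y(1) unfolding T_def by blast
      then show ?thesis using C by blast
    qed
  qed
  moreover have "z \<notin> Y" using Y(1) zW by blast
  then have "card (insert z Y) = Suc (Suc n)" using Y(2,3) by simp
  moreover have "insert z Y \<subseteq> Z" "finite (insert z Y)" using Y(1,2) W(1) z(1) by simp_all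
  ultimately show ?case by blast
qed

lemma free_at_Pow:
  assumes "is_aleph n Z" "finite X" "card X \<le> Suc n"
  shows "free_at Z (Pow X)"
proof (rule free_atI)
  fix S assume "set_mapping Z S"
  from kuratowski[OF assms(1) this] obtain Y
    where Y: "Y \<subseteq> Z" "finite Y" "card Y = Suc n" "\<forall>B\<subseteq>Y. S B \<inter> Y \<subseteq> B" by blast
  obtain u where u: "u ` X \<subseteq> Y" "inj_on u X"
    using card_le_inj[OF assms(2) Y(2)] assms(3) Y(3) by auto
  have "free_embedding Z S (Pow X) u"
  proof (rule free_embeddingI; unfold Union_Pow_eq)
    show "inj_on u X" by (rule u(2))
    show "u x \<in> Z" if "x \<in> X" for x using that u(1) Y(1) by blast
    fix A x assume A: "A \<in> Pow X" and x: "x \<in> X" "x \<notin> A"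
    have "u x \<notin> u ` A" using u(2) A x by (auto dest: inj_onD)
    moreover have "u ` A \<subseteq> Y" using u(1) A by blast
    ultimately show "u x \<notin> S (u ` A)" using Y(4) u(1) x(1) by blast
  qed
  then show "\<exists>u. free_embedding Z S (Pow X) u" by blast
qed

section \<open>Nested orders on the alephs\<close>

lemma nested_ordersI:
  assumes "\<And>xs. xs \<in> \<SS> \<Longrightarrow> set xs \<subseteq> X \<and> distinct xs"
    and "\<And>t. t \<in> X \<Longrightarrow> [t] \<in> \<SS>"
    and "\<And>ts s t. ts @ [s, t] \<in> \<SS> \<Longrightarrow> ts @ [s] \<in> \<SS> \<and> ts @ [t] \<in> \<SS>"
    and "\<And>ts s t u. ts @ [s, t] \<in> \<SS> \<Longrightarrow> ts @ [t, u] \<in> \<SS> \<Longrightarrow> ts @ [s, u] \<in> \<SS>"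
    and "\<And>ts s t. ts @ [t] \<in> \<SS> \<Longrightarrow> ts @ [s] \<in> \<SS> \<Longrightarrow> t \<noteq> s \<Longrightarrow>
        ts @ [t, s] \<in> \<SS> \<or> ts @ [s, t] \<in> \<SS>"
  shows "nested_orders X \<SS>"
proof -
  have "\<SS> \<subseteq> lists X" using assms(1) by (auto simp: in_lists_conv_set)
  then show ?thesis unfolding nested_orders_def using assms by (intro conjI allI impI ballI) blast+
qed

lemma nested_ordersD:
  assumes "nested_orders X \<SS>"
  shows nested_orders_set: "xs \<in> \<SS> \<Longrightarrow> set xs \<subseteq> X"
    and nested_orders_distinct: "xs \<in> \<SS> \<Longrightarrow> distinct xs"
    and nested_orders_singleton: "t \<in> X \<Longrightarrow> [t] \<in> \<SS>"
    and nested_orders_fst: "ts @ [s, t] \<in> \<SS> \<Longrightarrow> ts @ [s] \<in> \<SS>"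
    and nested_orders_snd: "ts @ [s, t] \<in> \<SS> \<Longrightarrow> ts @ [t] \<in> \<SS>"
    and nested_orders_trans: "ts @ [s, t] \<in> \<SS> \<Longrightarrow> ts @ [t, u] \<in> \<SS> \<Longrightarrow> ts @ [s, u] \<in> \<SS>"
    and nested_orders_total:
      "ts @ [t] \<in> \<SS> \<Longrightarrow> ts @ [s] \<in> \<SS> \<Longrightarrow> t \<noteq> s \<Longrightarrow> ts @ [t, s] \<in> \<SS> \<or> ts @ [s, t] \<in> \<SS>"
proof -
  have D: "\<SS> \<subseteq> lists X" "\<forall>t\<in>X. [t] \<in> \<SS>" "\<forall>ts\<in>\<SS>. distinct ts"
    "\<forall>ts s t. ts @ [s, t] \<in> \<SS> \<longrightarrow> ts @ [s] \<in> \<SS> \<and> ts @ [t] \<in> \<SS>"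
    "\<forall>ts s t u. ts @ [s, t] \<in> \<SS> \<and> ts @ [t, u] \<in> \<SS> \<longrightarrow> ts @ [s, u] \<in> \<SS>"
    "\<forall>ts s t. ts @ [t] \<in> \<SS> \<and> ts @ [s] \<in> \<SS> \<and> t \<noteq> s \<longrightarrow>
        ts @ [t, s] \<in> \<SS> \<or> ts @ [s, t] \<in> \<SS>"
    using assms unfolding nested_orders_def by - (elim conjE, assumption)+
  show "xs \<in> \<SS> \<Longrightarrow> set xs \<subseteq> X" using D(1) by (auto simp: in_lists_conv_set)
  show "xs \<in> \<SS> \<Longrightarrow> distinct xs" using D(3) by (rule bspec)
  show "t \<in> X \<Longrightarrow> [t] \<in> \<SS>" using D(2) by (rule bspec)
  show "ts @ [s, t] \<in> \<SS> \<Longrightarrow> ts @ [s] \<in> \<SS>" "ts @ [s, t] \<in> \<SS> \<Longrightarrow> ts @ [t] \<in> \<SS>"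
    using D(4) by blast+
  show "ts @ [s, t] \<in> \<SS> \<Longrightarrow> ts @ [t, u] \<in> \<SS> \<Longrightarrow> ts @ [s, u] \<in> \<SS>" using D(5) by blast
  show "ts @ [t] \<in> \<SS> \<Longrightarrow> ts @ [s] \<in> \<SS> \<Longrightarrow> t \<noteq> s \<Longrightarrow> ts @ [t, s] \<in> \<SS> \<or> ts @ [s, t] \<in> \<SS>"
    using D(6) by blast
qed

lemma nested_orders_vimage:
  assumes "nested_orders Z \<SS>" "inj_on u X" "u ` X \<subseteq> Z"
  shows "nested_orders X {xs \<in> lists X. map u xs \<in> \<SS>}"
proof (rule nested_ordersI)
  note D = nested_ordersD[OF assms(1)]
  show "set xs \<subseteq> X \<and> distinct xs" if "xs \<in> {xs \<in> lists X. map u xs \<in> \<SS>}" for xs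
    using that nested_orders_distinct[OF assms(1), of "map u xs"] by (auto simp: distinct_map in_lists_conv_set)
  show "[t] \<in> {xs \<in> lists X. map u xs \<in> \<SS>}" if "t \<in> X" for t
    using that assms(3) D(3) by auto
  show "ts @ [s] \<in> {xs \<in> lists X. map u xs \<in> \<SS>} \<and> ts @ [t] \<in> {xs \<in> lists X. map u xs \<in> \<SS>}"
    if "ts @ [s, t] \<in> {xs \<in> lists X. map u xs \<in> \<SS>}" for ts s t
    using that D(4)[of "map u ts" "u s" "u t"] D(5)[of "map u ts" "u s" "u t"] by simp
  show "ts @ [s, v] \<in> {xs \<in> lists X. map u xs \<in> \<SS>}"
    if "ts @ [s, t] \<in> {xs \<in> lists X. map u xs \<in> \<SS>}" "ts @ [t, v] \<in> {xs \<in> lists X. map u xs \<in> \<SS>}"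
    for ts s t v
    using that D(6)[of "map u ts" "u s" "u t" "u v"] by simp
  show "ts @ [t, s] \<in> {xs \<in> lists X. map u xs \<in> \<SS>} \<or> ts @ [s, t] \<in> {xs \<in> lists X. map u xs \<in> \<SS>}"
    if "ts @ [t] \<in> {xs \<in> lists X. map u xs \<in> \<SS>}" "ts @ [s] \<in> {xs \<in> lists X. map u xs \<in> \<SS>}" "t \<noteq> s"
    for ts s t
    using that D(7)[of "map u ts" "u t" "u s"] inj_on_eq_iff[OF assms(2), of s t] by simp
qed

text \<open>
  The finiteness condition makes the set of one-point extensions of sequences of length \<open>k\<close> from a
  finite set a legitimate value of a set mapping.
\<close>

definition narrow_nested_orders :: "nat \<Rightarrow> 'a set \<Rightarrow> 'a list set \<Rightarrow> bool" where
  "narrow_nested_orders k X \<SS> \<longleftrightarrow>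
     nested_orders X \<SS> \<and> (\<forall>ts. length ts = k \<longrightarrow> finite {t. ts @ [t] \<in> \<SS>})"

text \<open>
  Take the sequences that decrease along an injection into the natural numbers.
\<close>

lemma narrow_nested_orders_countable:
  assumes "countable Z"
  shows "\<exists>\<SS>. narrow_nested_orders 1 Z \<SS>"
proof -
  obtain e :: "'a \<Rightarrow> nat" where e: "inj_on e Z" using assms by (rule countableE)
  let ?\<SS> = "{xs. xs \<noteq> [] \<and> set xs \<subseteq> Z \<and> sorted_wrt (\<lambda>x y. e x > e y) xs}"
  have "nested_orders Z ?\<SS>"
  proof (rule nested_ordersI)
    show "set xs \<subseteq> Z \<and> distinct xs" if "xs \<in> ?\<SS>" for xs
    proof -
      have "sorted_wrt (\<lambda>x y. e x > e y) xs \<Longrightarrow> distinct xs" by (induction xs) auto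
      then show ?thesis using that by simp
    qed
    show "ts @ [t, s] \<in> ?\<SS> \<or> ts @ [s, t] \<in> ?\<SS>" if "ts @ [t] \<in> ?\<SS>" "ts @ [s] \<in> ?\<SS>" "t \<noteq> s" for ts s t
      using that inj_on_eq_iff[OF e, of s t] by (auto simp: sorted_wrt_append)
  qed (auto simp: sorted_wrt_append)
  moreover have "finite {t. ts @ [t] \<in> ?\<SS>}" if len: "length ts = 1" for ts
  proof -
    obtain s where s: "ts = [s]" using len by (cases ts) auto
    have "{t. ts @ [t] \<in> ?\<SS>} \<subseteq> e -` {..<e s} \<inter> Z" using s by auto
    then show ?thesis using finite_vimage_IntI[OF _ e, of "{..<e s}"] finite_subset by blast
  qed
  ultimately show ?thesis unfolding narrow_nested_orders_def by blast
qed

text \<open>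
  Here \<open>L z\<close> is the initial segment below \<open>z\<close>. A sequence starting with \<open>z\<close> continues inside
  \<open>L z\<close> according to the nested orders chosen there, so the narrowness level grows by one.
\<close>

lemma narrow_nested_orders_Suc:
  assumes down: "\<And>z. z \<in> Z \<Longrightarrow> L z \<subseteq> Z" and irrefl: "\<And>z. z \<notin> L z"
    and trans: "\<And>s t u. t \<in> L s \<Longrightarrow> u \<in> L t \<Longrightarrow> u \<in> L s"
    and total: "\<And>s t. s \<in> Z \<Longrightarrow> t \<in> Z \<Longrightarrow> s \<noteq> t \<Longrightarrow> s \<in> L t \<or> t \<in> L s"
    and T: "\<And>z. z \<in> Z \<Longrightarrow> narrow_nested_orders k (L z) (T z)"
  shows "\<exists>\<SS>. narrow_nested_orders (Suc k) Z \<SS>"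
proof -
  let ?\<SS> = "{xs. \<exists>z ts. xs = z # ts \<and> z \<in> Z \<and> (ts = [] \<or> ts \<in> T z)}"
  have N: "nested_orders (L z) (T z)" if "z \<in> Z" for z
    using T[OF that] by (simp add: narrow_nested_orders_def)
  note D = nested_ordersD[OF N]
  have single: "[t] \<in> T z \<longleftrightarrow> t \<in> L z" if "z \<in> Z" for t z
    using D(1)[OF that, of "[t]"] D(3)[OF that, of t] by auto
  have "nested_orders Z ?\<SS>"
  proof (rule nested_ordersI)
    fix xs assume "xs \<in> ?\<SS>"
    then obtain z ts where xs: "xs = z # ts" "z \<in> Z" "ts = [] \<or> ts \<in> T z" by blast
    then have "set ts \<subseteq> L z \<and> distinct ts" using D(1,2)[OF xs(2), of ts] by auto
    then show "set xs \<subseteq> Z \<and> distinct xs" using xs(1,2) down[OF xs(2)] irrefl[of z] by auto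
  next
    fix t assume "t \<in> Z" then show "[t] \<in> ?\<SS>" by simp
  next
    fix ts s t assume "ts @ [s, t] \<in> ?\<SS>"
    then show "ts @ [s] \<in> ?\<SS> \<and> ts @ [t] \<in> ?\<SS>"
      using D(4,5) down[THEN subsetD] single by (cases ts) auto
  next
    fix ts s t u assume "ts @ [s, t] \<in> ?\<SS>" "ts @ [t, u] \<in> ?\<SS>"
    then show "ts @ [s, u] \<in> ?\<SS>"
      using D(6) single trans by (cases ts) auto
  next
    fix ts s t assume "ts @ [t] \<in> ?\<SS>" "ts @ [s] \<in> ?\<SS>" "t \<noteq> s"
    then show "ts @ [t, s] \<in> ?\<SS> \<or> ts @ [s, t] \<in> ?\<SS>"
      using D(7) single total by (cases ts) auto
  qed
  moreover have "finite {t. ts @ [t] \<in> ?\<SS>}" if len: "length ts = Suc k" for ts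
  proof -
    obtain z ts' where ts: "ts = z # ts'" "length ts' = k" using len by (auto simp: length_Suc_conv)
    show ?thesis
    proof (cases "z \<in> Z")
      case True
      then have "{t. ts @ [t] \<in> ?\<SS>} = {t. ts' @ [t] \<in> T z}" using ts(1) by auto
      then show ?thesis using T[OF True] ts(2) by (simp add: narrow_nested_orders_def)
    qed (simp add: ts(1))
  qed
  ultimately show ?thesis unfolding narrow_nested_orders_def by blast
qed

text \<open>
  The relation \<open>|Z|\<close> well-orders \<open>Z\<close> with initial segments smaller than \<open>Z\<close>, hence of size
  at most \<open>\<aleph>\<^bsub>n-1\<^esub>\<close> when \<open>n > 0\<close>.
\<close>

lemma narrow_nested_orders_aleph:
  fixes W Z :: "'u set"
  assumes "is_aleph n W" "|Z| \<le>o |W|"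
  shows "\<exists>\<SS>. narrow_nested_orders (Suc n) Z \<SS>"
  using assms
proof (induction n arbitrary: W Z)
  case 0
  then have "countable W" using is_aleph_0_countable by blast
  then have "countable Z"
    unfolding countable_card_le_natLeq using 0(2) by (rule ordLeq_transitive[rotated])
  then show ?case using narrow_nested_orders_countable by auto
next
  case (Suc n)
  obtain V :: "'u set" where V: "is_aleph n V" "|W| =o cardSuc |V|" using Suc.prems(1) by auto
  let ?r = "|Z|"
  have wo: "Well_order ?r" and field: "Field ?r = Z"
    by (rule card_of_Well_order, rule Field_card_of)
  then have lin: "Linear_order ?r" by (simp add: well_order_on_def)
  then have tr: "trans ?r" and anti: "antisym ?r" and tot: "total_on Z ?r"
    by (simp_all add: order_on_defs field)
  show ?case
  proof (rule narrow_nested_orders_Suc)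
    show "underS ?r z \<subseteq> Z" for z using field by (auto simp: underS_def Field_def)
    show "z \<notin> underS ?r z" for z by (simp add: underS_def)
    show "u \<in> underS ?r s" if "t \<in> underS ?r s" "u \<in> underS ?r t" for s t u
      using that tr anti unfolding underS_def by (auto dest: transD antisymD)
    show "s \<in> underS ?r t \<or> t \<in> underS ?r s" if "s \<in> Z" "t \<in> Z" "s \<noteq> t" for s t
      using that tot unfolding underS_def total_on_def by blast
  next
    fix z assume "z \<in> Z"
    then have "|underS ?r z| <o |Z|"
      by (intro card_of_underS[OF card_of_Card_order]) (simp add: field)
    then have "|underS ?r z| <o cardSuc |V|"
      using ordLeq_ordIso_trans[OF Suc.prems(2) V(2)] by (rule ordLess_ordLeq_trans)
    then have "|underS ?r z| \<le>o |V|"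
      by (simp only: cardSuc_ordLeq_ordLess[OF card_of_Card_order card_of_Card_order])
    then show "narrow_nested_orders (Suc n) (underS ?r z) (SOME \<SS>. narrow_nested_orders (Suc n) (underS ?r z) \<SS>)"
      by (rule someI_ex[OF Suc.IH[OF V(1)]])
  qed
qed

text \<open>
  If \<open>ts @ [t]\<close> is a sequence of the pulled-back orders with \<open>ts\<close> in \<open>A\<close>, then \<open>u t\<close> belongs to
  \<open>S (u ` A)\<close>, and freeness puts \<open>t\<close> into \<open>A\<close>.
\<close>

lemma closed_sets_free_at:
  fixes Z :: "'u set"
  assumes Z: "is_aleph n Z" and fr: "free_at Z \<F>" and X: "X \<in> \<F>" "\<F> \<subseteq> Pow X"
  shows "\<exists>\<SS>. nested_orders X \<SS> \<and> \<F> \<subseteq> closed_sets X \<SS> n"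
proof -
  obtain \<TT> where T: "nested_orders Z \<TT>" "\<And>ts. length ts = Suc n \<Longrightarrow> finite {t. ts @ [t] \<in> \<TT>}"
    using narrow_nested_orders_aleph[OF Z card_of_mono1[OF subset_refl]]
    unfolding narrow_nested_orders_def by blast
  define S where "S B = (\<Union>ts\<in>{ts. set ts \<subseteq> B \<and> length ts = Suc n}. {t. ts @ [t] \<in> \<TT>})" for B
  have "set_mapping Z S"
    unfolding set_mapping_def
  proof (intro allI impI conjI)
    fix B assume B: "B \<subseteq> Z \<and> finite B"
    show "S B \<subseteq> Z" unfolding S_def using nested_orders_set[OF T(1)] by fastforce
    show "finite (S B)" unfolding S_def
      using B T(2) by (intro finite_UN_I finite_lists_length_eq) auto
  qed
  then obtain u where u: "free_embedding Z S \<F> u"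
    using fr unfolding free_at_iff_free_embedding by blast
  have UX: "\<Union>\<F> = X" using X by blast
  have "nested_orders X {xs \<in> lists X. map u xs \<in> \<TT>}"
    using free_embeddingD(1,2)[OF u] unfolding UX by (intro nested_orders_vimage[OF T(1)]) auto
  moreover have "\<F> \<subseteq> closed_sets X {xs \<in> lists X. map u xs \<in> \<TT>} n"
  proof
    fix A assume A: "A \<in> \<F>"
    have "t \<in> A" if ts: "ts @ [t] \<in> lists X" "map u (ts @ [t]) \<in> \<TT>" "length ts = n + 1" "set ts \<subseteq> A" for ts t
    proof (rule ccontr)
      assume "t \<notin> A"
      moreover have "t \<in> \<Union>\<F>" using ts(1) UX by simp
      ultimately have "u t \<notin> S (u ` A)" using free_embeddingD(3)[OF u A] by blast
      moreover have "u t \<in> S (u ` A)"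
        unfolding S_def using ts by (intro UN_I[of "map u ts"]) auto
      ultimately show False by blast
    qed
    then show "A \<in> closed_sets X {xs \<in> lists X. map u xs \<in> \<TT>} n"
      using A X(2) by (auto simp: closed_sets_def)
  qed
  ultimately show ?thesis by blast
qed

section \<open>Families of closed sets of nested orders\<close>

lemma nested_orders_maximum:
  assumes N: "nested_orders X \<SS>" and "finite R" "R \<noteq> {}" "\<And>s. s \<in> R \<Longrightarrow> ts @ [s] \<in> \<SS>"
  shows "\<exists>r\<in>R. \<forall>s\<in>R - {r}. ts @ [r, s] \<in> \<SS>"
  using assms(2-)
proof (induction R rule: finite_ne_induct)
  case (singleton x)
  then show ?case by simp
next
  case (insert x R)
  then obtain r where r: "r \<in> R" "\<forall>s\<in>R - {r}. ts @ [r, s] \<in> \<SS>" by auto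
  have "ts @ [x, r] \<in> \<SS> \<or> ts @ [r, x] \<in> \<SS>"
    using insert.prems insert.hyps(3) r(1) by (intro nested_orders_total[OF N]) auto
  then show ?case
  proof
    assume x: "ts @ [x, r] \<in> \<SS>"
    have "ts @ [x, s] \<in> \<SS>" if "s \<in> R" for s
      using nested_orders_trans[OF N x] r(2) that x by (cases "s = r") auto
    then show ?case by auto
  next
    assume "ts @ [r, x] \<in> \<SS>"
    then show ?case using r by auto
  qed
qed

lemma closed_sets_0_linearly_ordered:
  assumes N: "nested_orders X \<SS>"
  shows "linearly_ordered (closed_sets X \<SS> 0)"
  unfolding linearly_ordered_def
proof (intro ballI; rule ccontr)
  fix A B assume A: "A \<in> closed_sets X \<SS> 0" and B: "B \<in> closed_sets X \<SS> 0"
    and "\<not> (A \<subseteq> B \<or> B \<subseteq> A)"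
  then obtain a b where ab: "a \<in> A" "a \<notin> B" "b \<in> B" "b \<notin> A" by blast
  have closed: "t \<in> C" if "C \<in> closed_sets X \<SS> 0" "[s] @ [t] \<in> \<SS>" "s \<in> C" for C s t
    using that(1,3) that(2) unfolding closed_sets_def by (auto dest: spec[of _ "[s]"])
  have "a \<in> X" "b \<in> X" using A B ab by (auto simp: closed_sets_def)
  then have "[] @ [a, b] \<in> \<SS> \<or> [] @ [b, a] \<in> \<SS>"
    using ab by (intro nested_orders_total[OF N]) (auto simp: nested_orders_singleton[OF N])
  then show False using closed A B ab by (metis append_Cons append_Nil)
qed

text \<open>
  Pick greatest elements repeatedly, each one in the order given by those picked before.
\<close>

lemma nested_orders_full_sequence:
  assumes N: "nested_orders X \<SS>" and "finite R" "R \<noteq> {}" "\<And>s. s \<in> R \<Longrightarrow> ts @ [s] \<in> \<SS>"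
  shows "\<exists>rs. rs \<noteq> [] \<and> set rs = R \<and> length rs = card R \<and> ts @ rs \<in> \<SS>"
  using assms(2-)
proof (induction "card R" arbitrary: R ts)
  case 0
  then show ?case by simp
next
  case (Suc k)
  obtain r where r: "r \<in> R" "\<forall>s\<in>R - {r}. ts @ [r, s] \<in> \<SS>"
    using nested_orders_maximum[OF N Suc.prems] by blast
  show ?case
  proof (cases "R = {r}")
    case True
    then show ?thesis using Suc.prems(3) by (intro exI[of _ "[r]"]) auto
  next
    case False
    have "card (R - {r}) = k" using Suc.hyps(2) r(1) Suc.prems(1) by simp
    then obtain rs where rs: "rs \<noteq> []" "set rs = R - {r}" "length rs = k" "(ts @ [r]) @ rs \<in> \<SS>"
      using Suc.hyps(1)[of "R - {r}" "ts @ [r]"] Suc.prems(1) False r by auto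
    then show ?thesis using r(1) Suc.hyps(2) by (intro exI[of _ "r # rs"]) auto
  qed
qed

text \<open>
  All but the last term of an enumeration of \<open>X\<close> by a sequence of the family form a set that is
  not closed.
\<close>

lemma Pow_not_closed:
  assumes N: "nested_orders X \<SS>" and X: "finite X" "card X = n + 2"
  shows "\<not> Pow X \<subseteq> closed_sets X \<SS> n"
proof
  assume P: "Pow X \<subseteq> closed_sets X \<SS> n"
  obtain rs where rs: "set rs = X" "length rs = n + 2" "rs \<in> \<SS>"
    using nested_orders_full_sequence[OF N X(1), of "[]"] X(2) nested_orders_singleton[OF N] by force
  then obtain ts t where ts: "rs = ts @ [t]" "length ts = n + 1"
    by (cases rs rule: rev_cases) auto
  have "distinct rs" using nested_orders_distinct[OF N rs(3)] .
  then have "t \<notin> set ts" using ts(1) by simp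
  moreover have "set ts \<in> closed_sets X \<SS> n" using P rs(1) ts(1) by auto
  then have "t \<in> set ts" using rs(3) ts unfolding closed_sets_def by auto
  ultimately show False by blast
qed

text \<open>
  Let \<open>r\<close> be the greatest point of the cycle and \<open>p\<close>, \<open>q\<close> its two neighbours. They are
  comparable in the order below \<open>r\<close>; if \<open>q\<close> is below \<open>p\<close>, a closed set containing \<open>r\<close> and \<open>p\<close>
  contains \<open>q\<close>, so its trace on the cycle is not the edge \<open>{r, p}\<close>. The other case is symmetric.
\<close>

lemma closed_sets_1_acyclic:
  assumes N: "nested_orders X \<SS>"
  shows "\<not> contains_cycle X (closed_sets X \<SS> 1)"
proof
  assume "contains_cycle X (closed_sets X \<SS> 1)"
  then obtain xs where xs: "set xs \<subseteq> X" "3 \<le> length xs" "distinct xs"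
    and cyc: "\<And>i. i < length xs \<Longrightarrow>
        {xs ! i, xs ! (Suc i mod length xs)} \<in> (\<lambda>B. B \<inter> set xs) ` closed_sets X \<SS> 1"
    unfolding contains_cycle_def by blast
  have closed: "v \<in> B" if "B \<in> closed_sets X \<SS> 1" "[s, t] @ [v] \<in> \<SS>" "s \<in> B" "t \<in> B" for B s t v
    using that(1,3,4) that(2) unfolding closed_sets_def by (auto dest: spec[of _ "[s, t]"])
  let ?k = "length xs"
  obtain r where r: "r \<in> set xs" "\<forall>s\<in>set xs - {r}. [] @ [r, s] \<in> \<SS>"
    using nested_orders_maximum[OF N, of "set xs" "[]"] xs(1,2) nested_orders_singleton[OF N] by force
  obtain i where i: "i < ?k" "xs ! i = r" using r(1) by (auto simp: in_set_conv_nth)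
  define p where "p = (if i = 0 then ?k - 1 else i - 1)"
  define q where "q = Suc i mod ?k"
  have p: "p < ?k" "Suc p mod ?k = i" using i(1) xs(2) by (auto simp: p_def)
  have q: "q < ?k" unfolding q_def using xs(2) by (intro mod_less_divisor) linarith
  have ne: "p \<noteq> i" "q \<noteq> i" "p \<noteq> q"
    using i(1) xs(2) by (auto simp: p_def q_def mod_Suc split: if_splits)
  obtain B where B: "B \<in> closed_sets X \<SS> 1" "{xs ! p, r} = B \<inter> set xs"
    using cyc[OF p(1)] p(2) i(2) by auto
  obtain C where C: "C \<in> closed_sets X \<SS> 1" "{r, xs ! q} = C \<inter> set xs"
    using cyc[OF i(1)] i(2) by (auto simp: q_def)
  have d: "xs ! p \<noteq> r" "xs ! q \<noteq> r" "xs ! p \<noteq> xs ! q"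
    using ne p(1) q i xs(3) by (auto simp: nth_eq_iff_index_eq)
  have mem: "xs ! p \<in> set xs" "xs ! q \<in> set xs" using p(1) q by auto
  have "[r] @ [xs ! p, xs ! q] \<in> \<SS> \<or> [r] @ [xs ! q, xs ! p] \<in> \<SS>"
    using r(2) mem d by (intro nested_orders_total[OF N]) auto
  then show False
  proof
    assume "[r] @ [xs ! p, xs ! q] \<in> \<SS>"
    then have "xs ! q \<in> B" using closed[OF B(1), of r "xs ! p" "xs ! q"] B(2) by auto
    then have "xs ! q \<in> {xs ! p, r}" unfolding B(2) using mem(2) by simp
    then show False using d by simp
  next
    assume "[r] @ [xs ! q, xs ! p] \<in> \<SS>"
    then have "xs ! p \<in> C" using closed[OF C(1), of r "xs ! q" "xs ! p"] C(2) by auto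
    then have "xs ! p \<in> {r, xs ! q}" unfolding C(2) using mem(1) by simp
    then show False using d by simp
  qed
qed

section \<open>Free configurations of four points\<close>

lemma infinite_diff_finite_obtain:
  assumes "infinite V" "finite N"
  obtains v where "v \<in> V" "v \<notin> N"
  using assms finite_subset[of V N] by blast

lemma countable_infinite_subset:
  assumes "infinite V"
  obtains U where "U \<subseteq> V" "countable U" "infinite U"
  using infinite_countable_subset'[OF assms] by blast

lemma countable_UN_finite:
  assumes "countable I" "\<And>i. i \<in> I \<Longrightarrow> finite (A i)"
  shows "countable (\<Union>i\<in>I. A i)"
  using assms by (simp add: countable_finite)

text \<open>
  The pigeonhole step that fixes one point of a configuration: every \<open>q\<close> has an admissible
  \<open>d\<close> among countably many, so a single \<open>d\<close> is admissible for uncountably many \<open>q\<close>.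
\<close>

lemma uncountable_avoid:
  assumes Q: "uncountable Q" and D: "countable D" "infinite D" and E: "\<And>q. q \<in> Q \<Longrightarrow> finite (E q)"
  obtains d where "d \<in> D" "uncountable {q \<in> Q. d \<notin> E q}"
proof (rule ccontr)
  assume "\<not> thesis"
  then have "countable (\<Union>d\<in>D. {q \<in> Q. d \<notin> E q})" using that D(1) by blast
  moreover have "Q \<subseteq> (\<Union>d\<in>D. {q \<in> Q. d \<notin> E q})"
  proof
    fix q assume q: "q \<in> Q"
    obtain d where "d \<in> D" "d \<notin> E q" using infinite_diff_finite_obtain[OF D(2) E[OF q]] .
    then show "q \<in> (\<Union>d\<in>D. {q \<in> Q. d \<notin> E q})" using q by blast
  qed
  ultimately show False using Q countable_subset by blast
qed

lemma uncountable_outside: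
  assumes "uncountable Z" "countable A"
  obtains z where "z \<in> Z" "z \<notin> A"
  using exists_outside[OF countable_ordLess[OF assms(2,1)]] .

lemma uncountable_free_pair:
  assumes Q: "uncountable Q" and E: "\<And>q. q \<in> Q \<Longrightarrow> finite (E q)"
  obtains x y where "x \<in> Q" "y \<in> Q" "x \<notin> E y" "y \<notin> E x"
proof -
  obtain V where V: "V \<subseteq> Q" "countable V" "infinite V"
    using countable_infinite_subset[OF uncountable_infinite[OF Q]] .
  have "|E q| <o |V|" if "q \<in> Q" for q
    using E[OF that] V(3)
    by (simp add: finite_ordLess_infinite[OF card_of_Well_order card_of_Well_order] Field_card_of)
  then show thesis using free_pair[OF V(3) countable_ordLess[OF V(2) Q]] that by blast
qed

text \<open>
  First \<open>y4\<close> and then \<open>y3\<close> are fixed so that uncountably many candidates for \<open>y1\<close>, \<open>y2\<close> remain;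
  among those there is a free pair for \<open>q \<mapsto> S {q, y3, y4}\<close>. The condition \<open>y4 \<notin> S {y3}\<close> is arranged
  beforehand by choosing \<open>y4\<close> outside the values of \<open>S\<close> on the countable reservoir \<open>V\<close> for \<open>y3\<close>.
\<close>

lemma star_configuration:
  assumes Z: "uncountable Z" and S: "set_mapping Z S"
  obtains y1 y2 y3 y4 where "y1 \<in> Z" "y2 \<in> Z" "y3 \<in> Z" "y4 \<in> Z"
    "y1 \<notin> S {y2, y3, y4}" "y2 \<notin> S {y1, y3, y4}" "y3 \<notin> S {y1, y4}" "y3 \<notin> S {y2, y4}"
    "y4 \<notin> S {y1}" "y4 \<notin> S {y2}" "y4 \<notin> S {y3}"
proof -
  note fin = set_mappingD(2)[OF S]
  obtain V where V: "V \<subseteq> Z" "countable V" "infinite V"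
    using countable_infinite_subset[OF uncountable_infinite[OF Z]] .
  have "countable (\<Union>v\<in>V. S {v})"
    using V(1,2) by (intro countable_UN_finite fin) auto
  then have "infinite (Z - (\<Union>v\<in>V. S {v}))"
    using uncountable_minus_countable[OF Z] uncountable_infinite by blast
  then obtain D where D: "D \<subseteq> Z - (\<Union>v\<in>V. S {v})" "countable D" "infinite D"
    by (rule countable_infinite_subset)
  obtain y4 where y4: "y4 \<in> D" "uncountable {q \<in> Z. y4 \<notin> S {q}}"
    by (rule uncountable_avoid[OF Z D(2,3), of "\<lambda>q. S {q}"]) (auto intro: fin)
  have y4Z: "y4 \<in> Z" using y4(1) D(1) by blast
  define Q where "Q = {q \<in> Z. y4 \<notin> S {q}}"
  have Q: "uncountable Q" "Q \<subseteq> Z" using y4(2) by (auto simp: Q_def)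
  obtain y3 where y3: "y3 \<in> V" "uncountable {q \<in> Q. y3 \<notin> S {q, y4}}"
    by (rule uncountable_avoid[OF Q(1) V(2,3), of "\<lambda>q. S {q, y4}"]) (use Q(2) y4Z in \<open>auto intro: fin\<close>)
  have y3Z: "y3 \<in> Z" using y3(1) V(1) by blast
  obtain x y where xy: "x \<in> Q" "y \<in> Q" "y3 \<notin> S {x, y4}" "y3 \<notin> S {y, y4}"
    "x \<notin> S {y, y3, y4}" "y \<notin> S {x, y3, y4}"
    by (rule uncountable_free_pair[OF y3(2), of "\<lambda>q. S {q, y3, y4}"])
      (use Q(2) y3Z y4Z in \<open>auto intro: fin\<close>)
  show thesis
    using xy y3(1) y4(1) y3Z y4Z Q(2) D(1) by (intro that[of x y y3 y4]) (auto simp: Q_def)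
qed

text \<open>
  The point \<open>y1\<close> is chosen to avoid countably many finite sets, and afterwards \<open>y3\<close>, \<open>y4\<close>, \<open>y2\<close> must be
  found, in this order, each outside one finite set. So every choice must range over an
  infinite set while the conditions that do not involve \<open>y1\<close>, namely \<open>y4 \<notin> S {y2}\<close> and
  \<open>y3 \<notin> S {y2, y4}\<close>, hold automatically. The sets \<open>G v d\<close> of candidates for \<open>y2\<close> given \<open>y3 = v\<close>
  and \<open>y4 = d\<close> make this possible: all but finitely many \<open>v\<close> have infinitely many \<open>d\<close> with
  \<open>G v d\<close> infinite.
\<close>

lemma path_configuration:
  assumes Z: "uncountable Z" and S: "set_mapping Z S"
  obtains y1 y2 y3 y4 where "y1 \<in> Z" "y2 \<in> Z" "y3 \<in> Z" "y4 \<in> Z"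
    "y1 \<notin> S {y2, y3, y4}" "y2 \<notin> S {y1, y3, y4}" "y3 \<notin> S {y1}" "y3 \<notin> S {y2, y4}"
    "y4 \<notin> S {y1, y3}" "y4 \<notin> S {y2}"
proof -
  note fin = set_mappingD(2)[OF S]
  define G where "G v d = {y \<in> Z. d \<notin> S {y} \<and> v \<notin> S {y, d}}" for v d
  define P where "P v = {d \<in> Z. infinite (G v d)}" for v
  \<comment> \<open>Otherwise there are infinite sets \<open>V\<close>, \<open>D\<close> with all \<open>G v d\<close> finite; but a point \<open>y\<close>
    outside these countably many sets lies in some \<open>G v d\<close> by choosing \<open>d\<close> and then \<open>v\<close>.\<close>
  have "finite {v \<in> Z. finite (P v)}"
  proof (rule ccontr)
    assume "infinite {v \<in> Z. finite (P v)}"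
    then obtain V where V: "V \<subseteq> {v \<in> Z. finite (P v)}" "countable V" "infinite V"
      by (rule countable_infinite_subset)
    have "countable (\<Union>v\<in>V. P v)" using V by (intro countable_UN_finite) auto
    then have "infinite (Z - (\<Union>v\<in>V. P v))"
      using uncountable_minus_countable[OF Z] uncountable_infinite by blast
    then obtain D where D: "D \<subseteq> Z - (\<Union>v\<in>V. P v)" "countable D" "infinite D"
      by (rule countable_infinite_subset)
    have "countable (\<Union>v\<in>V. \<Union>d\<in>D. G v d)"
      using D(1) by (intro countable_UN[OF V(2)] countable_UN_finite[OF D(2)]) (auto simp: P_def)
    then obtain y where y: "y \<in> Z" "y \<notin> (\<Union>v\<in>V. \<Union>d\<in>D. G v d)"
      by (rule uncountable_outside[OF Z])
    obtain d where d: "d \<in> D" "d \<notin> S {y}"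
      by (rule infinite_diff_finite_obtain[OF D(3) fin[of "{y}"]]) (use y(1) in auto)
    obtain v where "v \<in> V" "v \<notin> S {y, d}"
      by (rule infinite_diff_finite_obtain[OF V(3) fin[of "{y, d}"]]) (use y(1) d(1) D(1) in auto)
    then show False using y d by (auto simp: G_def)
  qed
  then have "infinite (Z - {v \<in> Z. finite (P v)})" using uncountable_infinite[OF Z] by simp
  then obtain V where V: "V \<subseteq> Z - {v \<in> Z. finite (P v)}" "countable V" "infinite V"
    by (rule countable_infinite_subset)
  have "\<exists>U\<subseteq>P v. countable U \<and> infinite U" if "v \<in> V" for v
    using that V(1) by (intro infinite_countable_subset') auto
  then obtain D where D: "\<And>v. v \<in> V \<Longrightarrow> D v \<subseteq> P v \<and> countable (D v) \<and> infinite (D v)" by metis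
  define Q where "Q v d = (SOME U. U \<subseteq> G v d \<and> countable U \<and> infinite U)" for v d
  have Q: "Q v d \<subseteq> G v d \<and> countable (Q v d) \<and> infinite (Q v d)" if "d \<in> P v" for v d
  proof -
    have "infinite (G v d)" using that by (simp add: P_def)
    then have "\<exists>U. U \<subseteq> G v d \<and> countable U \<and> infinite U"
      using infinite_countable_subset'[of "G v d"] by blast
    then show ?thesis unfolding Q_def by (rule someI_ex)
  qed
  have PZ: "d \<in> Z" if "d \<in> P v" for v d using that by (simp add: P_def)
  have QZ: "q \<in> Z" "d \<notin> S {q}" "v \<notin> S {q, d}" if "d \<in> P v" "q \<in> Q v d" for v d q
    using Q[OF that(1)] that(2) by (auto simp: G_def)
  have "countable (\<Union>v\<in>V. \<Union>d\<in>D v. \<Union>q\<in>Q v d. S {q, v, d})"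
  proof (intro countable_UN)
    show "countable V" by (rule V(2))
    fix v assume v: "v \<in> V"
    then show "countable (D v)" using D by blast
    fix d assume "d \<in> D v"
    then have d: "d \<in> P v" using D[OF v] by blast
    then show "countable (Q v d)" using Q by blast
    fix q assume q: "q \<in> Q v d"
    show "countable (S {q, v, d})"
      using QZ(1)[OF d q] PZ[OF d] V(1) v by (intro countable_finite fin) auto
  qed
  then obtain y1 where y1: "y1 \<in> Z" "y1 \<notin> (\<Union>v\<in>V. \<Union>d\<in>D v. \<Union>q\<in>Q v d. S {q, v, d})"
    by (rule uncountable_outside[OF Z])
  obtain v where v: "v \<in> V" "v \<notin> S {y1}"
    by (rule infinite_diff_finite_obtain[OF V(3) fin[of "{y1}"]]) (use y1(1) in auto)
  have vZ: "v \<in> Z" using v(1) V(1) by blast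
  have "infinite (D v)" using D[OF v(1)] by blast
  then obtain d where d: "d \<in> D v" "d \<notin> S {y1, v}"
    by (rule infinite_diff_finite_obtain[OF _ fin[of "{y1, v}"]]) (use y1(1) vZ in auto)
  have dP: "d \<in> P v" using d(1) D[OF v(1)] by blast
  have dZ: "d \<in> Z" using PZ[OF dP] .
  have "infinite (Q v d)" using Q[OF dP] by blast
  then obtain q where q: "q \<in> Q v d" "q \<notin> S {y1, v, d}"
    by (rule infinite_diff_finite_obtain[OF _ fin[of "{y1, v, d}"]]) (use y1(1) vZ dZ in auto)
  show thesis
    by (rule that[of y1 q v d]) (use y1 v d q vZ dZ QZ[OF dP q(1)] in auto)
qed

text \<open>
  The points \<open>y3\<close> and \<open>y4\<close> come from countable infinite sets \<open>V\<close> and \<open>D\<close>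
  and are chosen last, so that \<open>y4 \<notin> S {y1, y2}\<close> and \<open>y3 \<notin> S {y1, y2, y4}\<close> cost nothing. Then \<open>y1\<close> and \<open>y2\<close>
  only have to avoid countable sets, and \<open>free_pair\<close> applies. What remains is that \<open>y4\<close> lies outside
  \<open>S {y1, y3}\<close> and \<open>S {y2, y3}\<close>: for each \<open>y\<close> the set \<open>C y\<close> of points reached from \<open>y\<close> and \<open>V\<close> is
  countable, so it misses one of \<open>|W|\<close> many disjoint candidates for \<open>D\<close>, and the same candidate
  works for all \<open>y\<close> in a set \<open>Q\<close> larger than \<open>W\<close>.
\<close>

lemma triple_configuration:
  assumes W: "W \<subseteq> Z" "uncountable W" "|W| <o |Z|" and S: "set_mapping Z S"
  obtains y1 y2 y3 y4 where "y1 \<in> Z" "y2 \<in> Z" "y3 \<in> Z" "y4 \<in> Z"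
    "y1 \<notin> S {y2, y3, y4}" "y2 \<notin> S {y1, y3, y4}" "y3 \<notin> S {y1, y2, y4}"
    "y4 \<notin> S {y1, y2}" "y4 \<notin> S {y1, y3}" "y4 \<notin> S {y2, y3}"
proof -
  note fin = set_mappingD(2)[OF S]
  note infW = uncountable_infinite[OF W(2)]
  obtain V where V: "V \<subseteq> W" "countable V" "infinite V"
    by (rule countable_infinite_subset[OF infW])
  define C where "C y = (\<Union>v\<in>V. S {y, v})" for y
  have C: "countable (C y)" if "y \<in> Z" for y
    unfolding C_def using V(1,2) W(1) that by (intro countable_UN_finite fin) auto
  have "|W \<times> (UNIV :: nat set)| =o |W|"
    using card_of_Times_infinite[OF infW, of "UNIV :: nat set"] infW infinite_iff_card_of_nat by blast
  then have "|W \<times> (UNIV :: nat set)| \<le>o |W|" by (rule ordIso_imp_ordLeq)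
  then obtain g where g: "inj_on g (W \<times> (UNIV :: nat set))" "g ` (W \<times> UNIV) \<subseteq> W"
    unfolding card_of_ordLeq[symmetric] by blast
  define D where "D i = (\<lambda>n. g (i, n)) ` UNIV" for i
  have D: "D i \<subseteq> Z" "countable (D i)" "infinite (D i)" if "i \<in> W" for i
  proof -
    have "inj (\<lambda>n. g (i, n))" using that by (auto intro!: injI dest: inj_onD[OF g(1)])
    then show "infinite (D i)" unfolding D_def by (rule range_inj_infinite)
    show "countable (D i)" by (simp add: D_def)
    show "D i \<subseteq> Z" using g(2) that W(1) by (auto simp: D_def)
  qed
  have "\<exists>i\<in>W. D i \<inter> C y = {}" if y: "y \<in> Z" for y
  proof (rule ccontr)
    assume "\<not> (\<exists>i\<in>W. D i \<inter> C y = {})"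
    then have "\<forall>i\<in>W. \<exists>n. g (i, n) \<in> C y" by (auto simp: D_def)
    then obtain n where n: "\<And>i. i \<in> W \<Longrightarrow> g (i, n i) \<in> C y" by metis
    have "inj_on (\<lambda>i. g (i, n i)) W" by (rule inj_onI) (auto dest: inj_onD[OF g(1)])
    moreover have "countable ((\<lambda>i. g (i, n i)) ` W)"
      using n by (intro countable_subset[OF _ C[OF y]]) auto
    ultimately show False using W(2) countable_image_inj_on by blast
  qed
  then obtain f where f: "\<And>y. y \<in> Z \<Longrightarrow> f y \<in> W \<and> D (f y) \<inter> C y = {}" by metis
  obtain i where i: "i \<in> W" "|W| <o |{y \<in> Z. f y = i}|"
    by (rule large_fibre[OF infW W(3) card_of_mono1[OF subset_refl], of f]) (use f in auto)
  let ?Q = "{y \<in> Z. f y = i}"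
  have sep: "d \<notin> S {y, v}" if "y \<in> ?Q" "d \<in> D i" "v \<in> V" for y d v
    using f[of y] that by (auto simp: C_def)
  define E where "E q = (\<Union>v\<in>V. \<Union>d\<in>D i. S {q, v, d})" for q
  have VZ: "V \<subseteq> Z" using V(1) W(1) by (rule subset_trans)
  have "|E q| <o |W|" if "q \<in> ?Q" for q
  proof (rule countable_ordLess[OF _ W(2)])
    have "finite (S {q, v, d})" if "v \<in> V" "d \<in> D i" for v d
      using that \<open>q \<in> ?Q\<close> VZ D(1)[OF i(1)] by (intro fin) auto
    then show "countable (E q)" unfolding E_def
      by (intro countable_UN[OF V(2)] countable_UN_finite[OF D(2)[OF i(1)]])
  qed
  then obtain x y where xy: "x \<in> ?Q" "y \<in> ?Q" "x \<notin> E y" "y \<notin> E x"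
    by (rule free_pair[OF infW i(2)])
  then have xyZ: "x \<in> Z" "y \<in> Z" by auto
  obtain d where d: "d \<in> D i" "d \<notin> S {x, y}"
    by (rule infinite_diff_finite_obtain[OF D(3)[OF i(1)] fin[of "{x, y}"]]) (use xyZ in auto)
  have dZ: "d \<in> Z" using d(1) D(1)[OF i(1)] by blast
  obtain v where v: "v \<in> V" "v \<notin> S {x, y, d}"
    by (rule infinite_diff_finite_obtain[OF V(3) fin[of "{x, y, d}"]]) (use xyZ dZ in auto)
  show thesis
    by (rule that[of x y v d])
      (use xyZ dZ v d VZ xy(3,4) sep[OF xy(1) d(1) v(1)] sep[OF xy(2) d(1) v(1)] in \<open>auto simp: E_def\<close>)
qed

text \<open>
  Whatever \<open>\<F>\<close> is, monotonicity covers the first two points by the conditions on the largest sets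
  omitting them. The families below differ only in what they require of the third and fourth point.
\<close>

lemma four_point_free_embedding:
  assumes S: "inflationary S" and abcd: "distinct [a, b, c, d]" and F: "\<F> \<subseteq> Pow {a, b, c, d}"
    and Z: "y1 \<in> Z" "y2 \<in> Z" "y3 \<in> Z" "y4 \<in> Z"
    and u: "u a = y1" "u b = y2" "u c = y3" "u d = y4"
    and y12: "y1 \<notin> S {y2, y3, y4}" "y2 \<notin> S {y1, y3, y4}" and "y3 \<noteq> y4"
    and y3: "\<And>A. A \<in> \<F> \<Longrightarrow> A \<subseteq> {a, b, d} \<Longrightarrow> y3 \<notin> S (u ` A)"
    and y4: "\<And>A. A \<in> \<F> \<Longrightarrow> A \<subseteq> {a, b, c} \<Longrightarrow> y4 \<notin> S (u ` A)"
  shows "free_embedding Z S \<F> u"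
proof -
  have sub: "\<Union>\<F> \<subseteq> {a, b, c, d}" using F by blast
  have neq: "y1 \<notin> {y2, y3, y4}" "y2 \<notin> {y1, y3, y4}"
    using y12 inflationary_upper[OF S, of "{y2, y3, y4}"] inflationary_upper[OF S, of "{y1, y3, y4}"]
    by auto
  have inj: "inj_on u {a, b, c, d}" using neq u \<open>y3 \<noteq> y4\<close> by auto
  show ?thesis
  proof (rule free_embeddingI)
    show "inj_on u (\<Union>\<F>)" using inj sub by (rule inj_on_subset)
    show "u x \<in> Z" if "x \<in> \<Union>\<F>" for x using that sub Z u by auto
    fix A x assume A: "A \<in> \<F>" and x: "x \<in> \<Union>\<F>" "x \<notin> A"
    have AX: "A \<subseteq> {a, b, c, d}" using A F by blast
    have mono: "S (u ` A) \<subseteq> S (u ` B)" if "A \<subseteq> B" for B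
      using that by (intro inflationary_mono[OF S] image_mono)
    consider "x = a" | "x = b" | "x = c" | "x = d" using x(1) sub by blast
    then show "u x \<notin> S (u ` A)"
    proof cases
      case 1
      then have "A \<subseteq> {b, c, d}" using AX x(2) by blast
      from mono[OF this] show ?thesis using y12(1) u 1 by auto
    next
      case 2
      then have "A \<subseteq> {a, c, d}" using AX x(2) by blast
      from mono[OF this] show ?thesis using y12(2) u 2 by auto
    next
      case 3
      then have "A \<subseteq> {a, b, d}" using AX x(2) by blast
      then show ?thesis using y3[OF A] u 3 by simp
    next
      case 4
      then have "A \<subseteq> {a, b, c}" using AX x(2) by blast
      then show ?thesis using y4[OF A] u 4 by simp
    qed
  qed
qed

section \<open>Free families of subsets of a four-element set\<close>

lemma subset_three_cases:
  assumes "A \<subseteq> {a, b, c}"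
  shows "A = {a, b, c} \<or> A \<subseteq> {a, b} \<or> A \<subseteq> {a, c} \<or> A \<subseteq> {b, c}"
  using assms by blast

lemma subset_two_cases:
  assumes "A \<subseteq> {a, b}"
  shows "A = {a, b} \<or> A \<subseteq> {a} \<or> A \<subseteq> {b}"
  using assms by blast

text \<open>
  As \<open>{a, b, c}\<close> is missing, members omitting \<open>d\<close> have at most two points, and this is the weakening
  of Kuratowski's condition that \<open>\<aleph>\<^sub>2\<close> suffices for.
\<close>

lemma free_at_missing_triple:
  assumes Z: "is_aleph 2 Z" and abcd: "distinct [a, b, c, d]"
    and F: "\<F> \<subseteq> Pow {a, b, c, d}" "{a, b, c} \<notin> \<F>"
  shows "free_at Z \<F>"
proof (rule free_atI)
  fix S assume S: "set_mapping Z S" "inflationary S"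
  have "is_aleph (Suc 1) Z" using Z by (simp only: Suc_1)
  then obtain W where W: "W \<subseteq> Z" "is_aleph 1 W" "|W| <o |Z|" by (rule is_aleph_Suc_subset)
  have "uncountable W" using is_aleph_Suc_uncountable[of 0 W] W(2) by simp
  from triple_configuration[OF W(1) this W(3) S(1)] obtain y1 y2 y3 y4 where
    y: "y1 \<in> Z" "y2 \<in> Z" "y3 \<in> Z" "y4 \<in> Z"
    "y1 \<notin> S {y2, y3, y4}" "y2 \<notin> S {y1, y3, y4}" "y3 \<notin> S {y1, y2, y4}"
    "y4 \<notin> S {y1, y2}" "y4 \<notin> S {y1, y3}" "y4 \<notin> S {y2, y3}" .
  define u where "u = (\<lambda>_. y4)(a := y1, b := y2, c := y3)"
  have u: "u a = y1" "u b = y2" "u c = y3" "u d = y4" using abcd by (auto simp: u_def)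
  have mono: "S (u ` A) \<subseteq> S (u ` B)" if "A \<subseteq> B" for A B
    using that by (intro inflationary_mono[OF S(2)] image_mono)
  have "free_embedding Z S \<F> u"
  proof (rule four_point_free_embedding[OF S(2) abcd F(1) y(1-4) u y(5,6)])
    show "y3 \<noteq> y4" using y(7) inflationary_upper[OF S(2), of "{y1, y2, y4}"] by auto
    show "y3 \<notin> S (u ` A)" if "A \<subseteq> {a, b, d}" for A
      using mono[OF that] y(7) u by auto
    show "y4 \<notin> S (u ` A)" if "A \<in> \<F>" "A \<subseteq> {a, b, c}" for A
    proof -
      have "A \<subseteq> {a, b} \<or> A \<subseteq> {a, c} \<or> A \<subseteq> {b, c}"
        using subset_three_cases[OF that(2)] that(1) F(2) by blast
      then show ?thesis using mono[of A "{a, b}"] mono[of A "{a, c}"] mono[of A "{b, c}"] y(8-10) u by auto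
    qed
  qed
  then show "\<exists>u. free_embedding Z S \<F> u" by blast
qed

text \<open>
  The pairs in \<open>\<F>\<close> all contain \<open>d\<close>. A member omitting \<open>c\<close> lies in \<open>{a, d}\<close> or in \<open>{b, d}\<close>, and
  one omitting \<open>d\<close> has at most one point; \<open>star_configuration\<close> provides for exactly these sets.
\<close>

lemma free_at_star:
  assumes Z: "uncountable Z" and abcd: "distinct [a, b, c, d]" and F: "\<F> \<subseteq> Pow {a, b, c, d}"
    and missing: "{a, b} \<notin> \<F>" "{b, c} \<notin> \<F>" "{a, c} \<notin> \<F>" "{a, b, c} \<notin> \<F>" "{a, b, d} \<notin> \<F>"
  shows "free_at Z \<F>"
proof (rule free_atI)
  fix S assume S: "set_mapping Z S" "inflationary S"
  from star_configuration[OF Z S(1)] obtain y1 y2 y3 y4 where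
    y: "y1 \<in> Z" "y2 \<in> Z" "y3 \<in> Z" "y4 \<in> Z"
    "y1 \<notin> S {y2, y3, y4}" "y2 \<notin> S {y1, y3, y4}" "y3 \<notin> S {y1, y4}" "y3 \<notin> S {y2, y4}"
    "y4 \<notin> S {y1}" "y4 \<notin> S {y2}" "y4 \<notin> S {y3}" .
  define u where "u = (\<lambda>_. y4)(a := y1, b := y2, c := y3)"
  have u: "u a = y1" "u b = y2" "u c = y3" "u d = y4" using abcd by (auto simp: u_def)
  have mono: "S (u ` A) \<subseteq> S (u ` B)" if "A \<subseteq> B" for A B
    using that by (intro inflationary_mono[OF S(2)] image_mono)
  have "free_embedding Z S \<F> u"
  proof (rule four_point_free_embedding[OF S(2) abcd F y(1-4) u y(5,6)])
    show "y3 \<noteq> y4" using y(7) inflationary_upper[OF S(2), of "{y1, y4}"] by auto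
    show "y3 \<notin> S (u ` A)" if "A \<in> \<F>" "A \<subseteq> {a, b, d}" for A
    proof -
      have "A \<subseteq> {a, d} \<or> A \<subseteq> {b, d}"
        using subset_three_cases[OF that(2)] subset_two_cases[of A a b] that(1) missing by blast
      then show ?thesis using mono[of A "{a, d}"] mono[of A "{b, d}"] y(7,8) u by auto
    qed
    show "y4 \<notin> S (u ` A)" if "A \<in> \<F>" "A \<subseteq> {a, b, c}" for A
    proof -
      have "A \<subseteq> {a} \<or> A \<subseteq> {b} \<or> A \<subseteq> {c}"
        using subset_three_cases[OF that(2)] subset_two_cases[of A a b] subset_two_cases[of A a c]
          subset_two_cases[of A b c] that(1) missing by blast
      then show ?thesis using mono[of A "{a}"] mono[of A "{b}"] mono[of A "{c}"] y(9-11) u by auto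
    qed
  qed
  then show "\<exists>u. free_embedding Z S \<F> u" by blast
qed

text \<open>
  The pairs in \<open>\<F>\<close> are edges of the path \<open>a\<close>, \<open>c\<close>, \<open>d\<close>, \<open>b\<close>. A member omitting \<open>c\<close> lies in \<open>{a}\<close>
  or in \<open>{b, d}\<close>, and one omitting \<open>d\<close> lies in \<open>{a, c}\<close> or in \<open>{b}\<close>; \<open>path_configuration\<close> provides for
  exactly these sets.
\<close>

lemma free_at_path:
  assumes Z: "uncountable Z" and abcd: "distinct [a, b, c, d]" and F: "\<F> \<subseteq> Pow {a, b, c, d}"
    and missing: "{a, b} \<notin> \<F>" "{b, c} \<notin> \<F>" "{a, d} \<notin> \<F>" "{a, b, c} \<notin> \<F>" "{a, b, d} \<notin> \<F>"
  shows "free_at Z \<F>"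
proof (rule free_atI)
  fix S assume S: "set_mapping Z S" "inflationary S"
  from path_configuration[OF Z S(1)] obtain y1 y2 y3 y4 where
    y: "y1 \<in> Z" "y2 \<in> Z" "y3 \<in> Z" "y4 \<in> Z"
    "y1 \<notin> S {y2, y3, y4}" "y2 \<notin> S {y1, y3, y4}" "y3 \<notin> S {y1}" "y3 \<notin> S {y2, y4}"
    "y4 \<notin> S {y1, y3}" "y4 \<notin> S {y2}" .
  define u where "u = (\<lambda>_. y4)(a := y1, b := y2, c := y3)"
  have u: "u a = y1" "u b = y2" "u c = y3" "u d = y4" using abcd by (auto simp: u_def)
  have mono: "S (u ` A) \<subseteq> S (u ` B)" if "A \<subseteq> B" for A B
    using that by (intro inflationary_mono[OF S(2)] image_mono)
  have "free_embedding Z S \<F> u"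
  proof (rule four_point_free_embedding[OF S(2) abcd F y(1-4) u y(5,6)])
    show "y3 \<noteq> y4" using y(8) inflationary_upper[OF S(2), of "{y2, y4}"] by auto
    show "y3 \<notin> S (u ` A)" if "A \<in> \<F>" "A \<subseteq> {a, b, d}" for A
    proof -
      have "A \<subseteq> {a} \<or> A \<subseteq> {b, d}"
        using subset_three_cases[OF that(2)] subset_two_cases[of A a b] subset_two_cases[of A a d]
          that(1) missing by blast
      then show ?thesis using mono[of A "{a}"] mono[of A "{b, d}"] y(7,8) u by auto
    qed
    show "y4 \<notin> S (u ` A)" if "A \<in> \<F>" "A \<subseteq> {a, b, c}" for A
    proof -
      have "A \<subseteq> {a, c} \<or> A \<subseteq> {b}"
        using subset_three_cases[OF that(2)] subset_two_cases[of A a b]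
          subset_two_cases[of A b c] that(1) missing by blast
      then show ?thesis using mono[of A "{a, c}"] mono[of A "{b}"] y(9,10) u by auto
    qed
  qed
  then show "\<exists>u. free_embedding Z S \<F> u" by blast
qed

section \<open>Families without a cycle\<close>

definition separated_pair :: "'a set set \<Rightarrow> 'a \<Rightarrow> 'a \<Rightarrow> 'a \<Rightarrow> 'a \<Rightarrow> bool" where
  "separated_pair \<F> a b c d \<longleftrightarrow> {a, b} \<notin> \<F> \<and> {a, b, c} \<notin> \<F> \<and> {a, b, d} \<notin> \<F> \<and>
     ({a, c} \<notin> \<F> \<or> {a, d} \<notin> \<F>) \<and> ({b, c} \<notin> \<F> \<or> {b, d} \<notin> \<F>)"

text \<open>
  Either \<open>a\<close> and \<open>b\<close> can only be joined to the same one of \<open>c\<close>, \<open>d\<close>, which gives a star, or to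
  different ones, which gives a path.
\<close>

lemma free_at_separated_pair:
  assumes Z: "uncountable Z" and abcd: "distinct [a, b, c, d]" and F: "\<F> \<subseteq> Pow {a, b, c, d}"
    and sep: "separated_pair \<F> a b c d"
  shows "free_at Z \<F>"
proof -
  have abdc: "distinct [a, b, d, c]" "\<F> \<subseteq> Pow {a, b, d, c}"
    using abcd F by (auto simp: insert_commute)
  note m = sep[unfolded separated_pair_def]
  consider "{a, c} \<notin> \<F>" "{b, c} \<notin> \<F>" | "{a, d} \<notin> \<F>" "{b, d} \<notin> \<F>"
    | "{a, d} \<notin> \<F>" "{b, c} \<notin> \<F>" | "{a, c} \<notin> \<F>" "{b, d} \<notin> \<F>"
    using m by blast
  then show ?thesis
  proof cases
    case 1 then show ?thesis using free_at_star[OF Z abcd F] m by blast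
  next
    case 2 then show ?thesis using free_at_star[OF Z abdc] m by blast
  next
    case 3 then show ?thesis using free_at_path[OF Z abcd F] m by blast
  next
    case 4 then show ?thesis using free_at_path[OF Z abdc] m by blast
  qed
qed

lemma cyclic_successors:
  "P a b \<Longrightarrow> P b c \<Longrightarrow> P c a \<Longrightarrow>
    \<forall>i<length [a, b, c]. P ([a, b, c] ! i) ([a, b, c] ! (Suc i mod length [a, b, c]))"
  "P a b \<Longrightarrow> P b c \<Longrightarrow> P c d \<Longrightarrow> P d a \<Longrightarrow>
    \<forall>i<length [a, b, c, d]. P ([a, b, c, d] ! i) ([a, b, c, d] ! (Suc i mod length [a, b, c, d]))"
  by (simp_all add: All_less_Suc)

text \<open>
  The trace of \<open>\<F>\<close> on \<open>{a, b, c}\<close> contains a pair \<open>P\<close> as soon as \<open>P\<close> or \<open>insert d P\<close> is in \<open>\<F>\<close>.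
\<close>

lemma acyclic_triangle:
  assumes "\<not> contains_cycle X \<F>" "distinct [a, b, c, d]" "{a, b, c} \<subseteq> X"
  shows "\<not> (({a, b} \<in> \<F> \<or> {a, b, d} \<in> \<F>) \<and> ({b, c} \<in> \<F> \<or> {b, c, d} \<in> \<F>) \<and> ({a, c} \<in> \<F> \<or> {a, c, d} \<in> \<F>))"
proof
  assume T: "({a, b} \<in> \<F> \<or> {a, b, d} \<in> \<F>) \<and> ({b, c} \<in> \<F> \<or> {b, c, d} \<in> \<F>) \<and> ({a, c} \<in> \<F> \<or> {a, c, d} \<in> \<F>)"
  let ?R = "(\<lambda>B. B \<inter> set [a, b, c]) ` \<F>"
  have trace: "P \<in> ?R" if "P \<in> \<F> \<or> insert d P \<in> \<F>" "P \<subseteq> {a, b, c}" for P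
  proof -
    have "P = P \<inter> set [a, b, c]" "P = insert d P \<inter> set [a, b, c]"
      using that(2) assms(2) by auto
    then show ?thesis using that(1) by blast
  qed
  have "{a, b} \<in> ?R" "{b, c} \<in> ?R" "{c, a} \<in> ?R"
    using T by (intro trace; simp add: insert_commute)+
  then have "\<forall>i<length [a, b, c]. {[a, b, c] ! i, [a, b, c] ! (Suc i mod length [a, b, c])} \<in> ?R"
    by (rule cyclic_successors(1)[of "\<lambda>s t. {s, t} \<in> ?R"])
  then have "contains_cycle X \<F>"
    unfolding contains_cycle_def using assms(2,3)
    by (intro exI[of _ "[a, b, c]"] conjI) (simp_all only:, simp_all)
  then show False using assms(1) by simp
qed

lemma acyclic_quadrangle:
  assumes "\<not> contains_cycle X \<F>" "distinct [a, b, c, d]" "{a, b, c, d} \<subseteq> X"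
  shows "\<not> ({a, b} \<in> \<F> \<and> {b, c} \<in> \<F> \<and> {c, d} \<in> \<F> \<and> {a, d} \<in> \<F>)"
proof
  assume Q: "{a, b} \<in> \<F> \<and> {b, c} \<in> \<F> \<and> {c, d} \<in> \<F> \<and> {a, d} \<in> \<F>"
  let ?R = "(\<lambda>B. B \<inter> set [a, b, c, d]) ` \<F>"
  have trace: "P \<in> ?R" if "P \<in> \<F>" "P \<subseteq> {a, b, c, d}" for P
    using that by (intro image_eqI[of _ _ P]) auto
  have "{a, b} \<in> ?R" "{b, c} \<in> ?R" "{c, d} \<in> ?R" "{d, a} \<in> ?R"
    using Q by (intro trace; simp add: insert_commute)+
  then have "\<forall>i<length [a, b, c, d].
      {[a, b, c, d] ! i, [a, b, c, d] ! (Suc i mod length [a, b, c, d])} \<in> ?R"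
    by (rule cyclic_successors(2)[of "\<lambda>s t. {s, t} \<in> ?R"])
  then have "contains_cycle X \<F>"
    unfolding contains_cycle_def using assms(2,3)
    by (intro exI[of _ "[a, b, c, d]"] conjI) (simp_all only:, simp_all)
  then show False using assms(1) by simp
qed

lemma intersection_closed_top: "intersection_closed X \<F> \<Longrightarrow> X \<in> \<F>"
  unfolding intersection_closed_def by (metis Inf_empty empty_subsetI inf_top_right)

lemma intersection_closed_Int:
  assumes "intersection_closed X \<F>" "\<F> \<subseteq> Pow X" "A \<in> \<F>" "B \<in> \<F>"
  shows "A \<inter> B \<in> \<F>"
proof -
  have "X \<inter> \<Inter>{A, B} \<in> \<F>" 
    using assms(1)[unfolded intersection_closed_def, rule_format, of "{A, B}"] assms(3,4) by simp
  moreover have "X \<inter> \<Inter>{A, B} = A \<inter> B" using assms(2,3) by auto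
  ultimately show ?thesis by simp
qed

text \<open>
  Which of the six pairs and four triples belong to \<open>\<F>\<close> is a propositional matter. The absence of
  triangles and quadrangles, together with closure of the triples under intersection, excludes that
  all six pairs of points fail to be separated.
\<close>

lemma acyclic_separated_pair:
  assumes closed: "intersection_closed X \<F>" and acyclic: "\<not> contains_cycle X \<F>"
    and F: "\<F> \<subseteq> Pow X" and X: "X = {w, x, y, z}" and d: "distinct [w, x, y, z]"
  obtains a b c d where "distinct [a, b, c, d]" "X = {a, b, c, d}" "separated_pair \<F> a b c d"
proof -
  have ne: "w \<noteq> x" "x \<noteq> w" "w \<noteq> y" "y \<noteq> w" "w \<noteq> z" "z \<noteq> w"
      "x \<noteq> y" "y \<noteq> x" "x \<noteq> z" "z \<noteq> x" "y \<noteq> z" "z \<noteq> y"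
    using d by auto
  have tri:
    "\<not> (({w, x} \<in> \<F> \<or> {w, x, z} \<in> \<F>) \<and> ({x, y} \<in> \<F> \<or> {x, y, z} \<in> \<F>) \<and> ({w, y} \<in> \<F> \<or> {w, y, z} \<in> \<F>))"
    "\<not> (({w, x} \<in> \<F> \<or> {w, x, y} \<in> \<F>) \<and> ({x, z} \<in> \<F> \<or> {x, y, z} \<in> \<F>) \<and> ({w, z} \<in> \<F> \<or> {w, y, z} \<in> \<F>))"
    "\<not> (({w, y} \<in> \<F> \<or> {w, x, y} \<in> \<F>) \<and> ({y, z} \<in> \<F> \<or> {x, y, z} \<in> \<F>) \<and> ({w, z} \<in> \<F> \<or> {w, x, z} \<in> \<F>))"
    "\<not> (({x, y} \<in> \<F> \<or> {w, x, y} \<in> \<F>) \<and> ({y, z} \<in> \<F> \<or> {w, y, z} \<in> \<F>) \<and> ({x, z} \<in> \<F> \<or> {w, x, z} \<in> \<F>))"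
    using acyclic_triangle[OF acyclic, of w x y z] acyclic_triangle[OF acyclic, of w x z y]
      acyclic_triangle[OF acyclic, of w y z x] acyclic_triangle[OF acyclic, of x y z w] ne X
    by (simp_all add: insert_commute)
  have quad: "\<not> ({w, x} \<in> \<F> \<and> {x, y} \<in> \<F> \<and> {y, z} \<in> \<F> \<and> {w, z} \<in> \<F>)"
    "\<not> ({w, x} \<in> \<F> \<and> {x, z} \<in> \<F> \<and> {y, z} \<in> \<F> \<and> {w, y} \<in> \<F>)"
    "\<not> ({w, y} \<in> \<F> \<and> {x, y} \<in> \<F> \<and> {x, z} \<in> \<F> \<and> {w, z} \<in> \<F>)"
    using acyclic_quadrangle[OF acyclic, of w x y z] acyclic_quadrangle[OF acyclic, of w x z y]
      acyclic_quadrangle[OF acyclic, of w y x z] ne X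
    by (simp_all add: insert_commute)
  note Int = intersection_closed_Int[OF closed F]
  have Int_eqs: "{w, x, y} \<inter> {w, x, z} = {w, x}"
    "{w, x, y} \<inter> {w, y, z} = {w, y}"
    "{w, x, y} \<inter> {x, y, z} = {x, y}"
    "{w, x, z} \<inter> {w, y, z} = {w, z}"
    "{w, x, z} \<inter> {x, y, z} = {x, z}"
    "{w, y, z} \<inter> {x, y, z} = {y, z}"
    using ne by auto
  have pairs: "{w, x, y} \<in> \<F> \<and> {w, x, z} \<in> \<F> \<longrightarrow> {w, x} \<in> \<F>"
    "{w, x, y} \<in> \<F> \<and> {w, y, z} \<in> \<F> \<longrightarrow> {w, y} \<in> \<F>"
    "{w, x, y} \<in> \<F> \<and> {x, y, z} \<in> \<F> \<longrightarrow> {x, y} \<in> \<F>"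
    "{w, x, z} \<in> \<F> \<and> {w, y, z} \<in> \<F> \<longrightarrow> {w, z} \<in> \<F>"
    "{w, x, z} \<in> \<F> \<and> {x, y, z} \<in> \<F> \<longrightarrow> {x, z} \<in> \<F>"
    "{w, y, z} \<in> \<F> \<and> {x, y, z} \<in> \<F> \<longrightarrow> {y, z} \<in> \<F>"
    using Int[of "{w, x, y}" "{w, x, z}"]
      Int[of "{w, x, y}" "{w, y, z}"]
      Int[of "{w, x, y}" "{x, y, z}"]
      Int[of "{w, x, z}" "{w, y, z}"]
      Int[of "{w, x, z}" "{x, y, z}"]
      Int[of "{w, y, z}" "{x, y, z}"]
    unfolding Int_eqs by simp_all
  have "separated_pair \<F> w x y z \<or> separated_pair \<F> w y x z \<or> separated_pair \<F> w z x y \<or>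
    separated_pair \<F> x y w z \<or> separated_pair \<F> x z w y \<or> separated_pair \<F> y z w x"
    using tri quad pairs unfolding separated_pair_def by (simp only: insert_commute) argo
  then show thesis
    using that[of w x y z] that[of w y x z] that[of w z x y] that[of x y w z] that[of x z w y]
      that[of y z w x] ne X
    by (elim disjE) (simp_all add: insert_commute)
qed

section \<open>Equality of the two invariants\<close>

text \<open>
  Two consecutive edges of a cycle are incomparable, hence so are members of \<open>\<F>\<close> inducing them.
\<close>

lemma linearly_ordered_acyclic:
  assumes "linearly_ordered \<F>"
  shows "\<not> contains_cycle X \<F>"
proof
  assume "contains_cycle X \<F>"
  then obtain xs where xs: "3 \<le> length xs" "distinct xs"
    and cyc: "\<And>i. i < length xs \<Longrightarrow> {xs ! i, xs ! (Suc i mod length xs)} \<in> (\<lambda>B. B \<inter> set xs) ` \<F>"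
    unfolding contains_cycle_def by blast
  have len: "0 < length xs" "1 < length xs" "2 < length xs" using xs(1) by linarith+
  note mem = len[THEN nth_mem]
  have ne: "xs ! 0 \<noteq> xs ! 1" "xs ! 0 \<noteq> xs ! 2" "xs ! 1 \<noteq> xs ! 2"
    using nth_eq_iff_index_eq[OF xs(2) len(1,2)] nth_eq_iff_index_eq[OF xs(2) len(1,3)]
      nth_eq_iff_index_eq[OF xs(2) len(2,3)] by simp_all
  have "{xs ! 0, xs ! 1} \<in> (\<lambda>B. B \<inter> set xs) ` \<F>" "{xs ! 1, xs ! 2} \<in> (\<lambda>B. B \<inter> set xs) ` \<F>"
    using cyc[OF len(1)] cyc[OF len(2)] xs(1) by (simp_all add: numeral_2_eq_2)
  then obtain B C where BC: "B \<in> \<F>" "C \<in> \<F>" "{xs ! 0, xs ! 1} = B \<inter> set xs" "{xs ! 1, xs ! 2} = C \<inter> set xs"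
    by (elim imageE)
  have "xs ! 0 \<in> B \<inter> set xs" "xs ! 2 \<notin> B \<inter> set xs" unfolding BC(3)[symmetric] using ne by auto
  moreover have "xs ! 2 \<in> C \<inter> set xs" "xs ! 0 \<notin> C \<inter> set xs" unfolding BC(4)[symmetric] using ne by auto
  moreover have "B \<subseteq> C \<or> C \<subseteq> B" using assms BC(1,2) by (simp add: linearly_ordered_def)
  ultimately show False using mem by auto
qed

text \<open>
  Every subset of \<open>X\<close> is an intersection of sets \<open>X - {t}\<close>.
\<close>

lemma intersection_closed_missing_coatom:
  assumes closed: "intersection_closed X \<F>" and "\<F> \<subseteq> Pow X" "\<F> \<noteq> Pow X"
  shows "\<exists>t\<in>X. X - {t} \<notin> \<F>"
proof (rule ccontr)
  assume "\<not> (\<exists>t\<in>X. X - {t} \<notin> \<F>)"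
  then have coatoms: "\<And>t. t \<in> X \<Longrightarrow> X - {t} \<in> \<F>" by simp
  have "A \<in> \<F>" if "A \<subseteq> X" for A
  proof -
    have "(\<lambda>t. X - {t}) ` (X - A) \<subseteq> \<F>" using coatoms by auto
    then have "X \<inter> \<Inter>((\<lambda>t. X - {t}) ` (X - A)) \<in> \<F>"
      by (rule closed[unfolded intersection_closed_def, rule_format])
    moreover have "X \<inter> \<Inter>((\<lambda>t. X - {t}) ` (X - A)) = A" using that by auto
    ultimately show ?thesis by simp
  qed
  then show False using assms(2,3) by blast
qed

lemma closed_sets_Inter:
  assumes "\<H> \<subseteq> closed_sets X \<SS> n"
    and N: "nested_orders X \<SS>"
  shows "X \<inter> \<Inter>\<H> \<in> closed_sets X \<SS> n"
  unfolding closed_sets_def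
proof (intro CollectI conjI allI impI)
  fix ts t assume t: "ts @ [t] \<in> \<SS> \<and> length ts = n + 1 \<and> set ts \<subseteq> X \<inter> \<Inter>\<H>"
  have "t \<in> X" using nested_orders_set[OF N, of "ts @ [t]"] t by simp
  moreover have "t \<in> A" if "A \<in> \<H>" for A
    using assms(1) that t unfolding closed_sets_def by blast
  ultimately show "t \<in> X \<inter> \<Inter>\<H>" by blast
qed simp

lemma no_intersection_closure:
  assumes "\<F> \<subseteq> Pow X"
  shows "no X (intersection_closure X \<F>) = no X \<F>"
proof -
  have "intersection_closure X \<F> \<subseteq> closed_sets X \<SS> n" if "nested_orders X \<SS>" "\<F> \<subseteq> closed_sets X \<SS> n"
    for \<SS> n
    unfolding intersection_closure_def
  proof (intro image_subsetI)
    fix \<H> assume "\<H> \<in> Pow \<F>"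
    then have "\<H> \<subseteq> closed_sets X \<SS> n" using that(2) by simp
    then show "X \<inter> \<Inter>\<H> \<in> closed_sets X \<SS> n" using that(1) by (rule closed_sets_Inter)
  qed
  moreover have "\<F> \<subseteq> closed_sets X \<SS> n" if "intersection_closure X \<F> \<subseteq> closed_sets X \<SS> n" for \<SS> n
    using subset_intersection_closure[OF assms] that by (rule subset_trans)
  ultimately have "(\<exists>\<SS>. nested_orders X \<SS> \<and> intersection_closure X \<F> \<subseteq> closed_sets X \<SS> n) \<longleftrightarrow>
      (\<exists>\<SS>. nested_orders X \<SS> \<and> \<F> \<subseteq> closed_sets X \<SS> n)" for n
    by metis
  then show ?thesis by (simp only: no_def)
qed

lemma fr_intersection_closure:
  assumes "\<F> \<subseteq> Pow X" "finite X"
  shows "fr TYPE('u) (intersection_closure X \<F>) = fr TYPE('u) \<F>"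
proof -
  have "free_at Z (intersection_closure X \<F>) \<longleftrightarrow> free_at Z \<F>" if "is_aleph n Z" for n and Z :: "'u set"
    using free_at_intersection_closure[OF is_aleph_infinite[OF that] assms(2,1)]
      free_at_subset[OF _ subset_intersection_closure[OF assms(1)]] by (rule iffI[rotated])
  then have "(\<exists>Z :: 'u set. is_aleph n Z \<and> free_at Z (intersection_closure X \<F>)) \<longleftrightarrow>
      (\<exists>Z :: 'u set. is_aleph n Z \<and> free_at Z \<F>)" for n
    by metis
  then show ?thesis by (simp only: fr_def)
qed

definition four_point_rank :: "'a set \<Rightarrow> 'a set set \<Rightarrow> nat" where
  "four_point_rank X \<F> =
     (if linearly_ordered \<F> then 0 else if \<not> contains_cycle X \<F> then 1
      else if \<F> \<noteq> Pow X then 2 else 3)"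

lemma four_point_rank_le:
  assumes X: "finite X" "card X = 4" and N: "nested_orders X \<SS>" and F: "\<F> \<subseteq> closed_sets X \<SS> n"
  shows "four_point_rank X \<F> \<le> n"
proof -
  consider "n = 0" | "n = 1" | "n = 2" | "3 \<le> n" by linarith
  then show ?thesis
  proof cases
    case 1
    then have "linearly_ordered \<F>"
      using closed_sets_0_linearly_ordered[OF N] F unfolding linearly_ordered_def by blast
    then show ?thesis by (simp add: four_point_rank_def)
  next
    case 2
    have "\<not> contains_cycle X \<F>"
      using closed_sets_1_acyclic[OF N] F unfolding 2 contains_cycle_def by (meson image_mono subsetD)
    then show ?thesis using 2 by (simp add: four_point_rank_def)
  next
    case 3
    then have "\<F> \<noteq> Pow X" using Pow_not_closed[OF N X(1), of 2] X(2) F by auto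
    then show ?thesis using 3 by (simp add: four_point_rank_def)
  next
    case 4
    then show ?thesis by (simp add: four_point_rank_def)
  qed
qed

text \<open>
  Each shape of \<open>\<F>\<close> is embedded at the aleph of its rank: a chain greedily, an acyclic family by a
  separated pair, a family missing a triple by \<open>triple_configuration\<close>, all subsets by Kuratowski.
\<close>

lemma free_at_four_point_rank:
  assumes universe: "\<exists>Z :: 'u set. is_aleph 3 Z"
    and X: "X = {w, x, y, z}" "distinct [w, x, y, z]"
    and F: "\<F> \<subseteq> Pow X" "intersection_closed X \<F>"
  shows "\<exists>Z :: 'u set. is_aleph (four_point_rank X \<F>) Z \<and> free_at Z \<F>"
proof -
  have "four_point_rank X \<F> \<le> 3" by (simp add: four_point_rank_def)
  then obtain Z :: "'u set" where Z: "is_aleph (four_point_rank X \<F>) Z"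
    using universe is_aleph_downward by blast
  have fin: "finite X" "card X = 4" using X by auto
  consider (0) "linearly_ordered \<F>" | (1) "\<not> linearly_ordered \<F>" "\<not> contains_cycle X \<F>"
    | (2) "\<not> linearly_ordered \<F>" "contains_cycle X \<F>" "\<F> \<noteq> Pow X"
    | (3) "\<not> linearly_ordered \<F>" "contains_cycle X \<F>" "\<F> = Pow X" by blast
  then have "free_at Z \<F>"
  proof cases
    case 0
    have "finite \<F>" "\<forall>A\<in>\<F>. finite A" using F(1) fin(1) by (auto intro: finite_subset)
    then show ?thesis using free_at_linearly_ordered[OF is_aleph_infinite[OF Z]] 0 by blast
  next
    case 1
    then have Z1: "is_aleph 1 Z" using Z by (simp add: four_point_rank_def)
    obtain a b c d where "distinct [a, b, c, d]" "X = {a, b, c, d}" "separated_pair \<F> a b c d"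
      using acyclic_separated_pair[OF F(2) 1(2) F(1) X] .
    then show ?thesis
      using free_at_separated_pair[of Z a b c d \<F>] is_aleph_Suc_uncountable[of 0 Z] Z1 F(1) by simp
  next
    case 2
    then have Z2: "is_aleph 2 Z" using Z by (simp add: four_point_rank_def)
    obtain t where t: "t \<in> X" "X - {t} \<notin> \<F>"
      using intersection_closed_missing_coatom[OF F(2,1) 2(3)] by blast
    have "card (X - {t}) = 3" using t(1) fin by simp
    then obtain a b c where abc: "X - {t} = {a, b, c}" "a \<noteq> b" "a \<noteq> c" "b \<noteq> c"
      unfolding card_3_iff by blast
    have "t \<notin> {a, b, c}" unfolding abc(1)[symmetric] by simp
    then have dist: "distinct [a, b, c, t]" using abc(2-4) by auto
    have "X = insert t {a, b, c}" unfolding abc(1)[symmetric] using t(1) by auto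
    then have "X = {a, b, c, t}" by (simp add: insert_commute)
    then show ?thesis using free_at_missing_triple[OF Z2 dist] F(1) abc(1) t(2) by simp
  next
    case 3
    then have "is_aleph 3 Z" using Z by (simp add: four_point_rank_def)
    then show ?thesis using free_at_Pow[of 3 Z X] fin 3(3) by simp
  qed
  then show ?thesis using Z by blast
qed

text \<open>
  Both minima are squeezed: the rank is attained by a free copy, each free copy yields nested
  orders, and nested orders at level \<open>n\<close> bound the rank by \<open>n\<close>.
\<close>

lemma fr_no_eq_four_point_rank:
  assumes universe: "\<exists>Z :: 'u set. is_aleph 3 Z"
    and X: "X = {w, x, y, z}" "distinct [w, x, y, z]"
    and F: "\<F> \<subseteq> Pow X" "intersection_closed X \<F>"
  shows "fr TYPE('u) \<F> = four_point_rank X \<F>" "no X \<F> = four_point_rank X \<F>"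
proof -
  have fin: "finite X" "card X = 4" using X by auto
  have nested: "\<exists>\<SS>. nested_orders X \<SS> \<and> \<F> \<subseteq> closed_sets X \<SS> n" if "is_aleph n Z" "free_at Z \<F>"
    for n and Z :: "'u set"
    using closed_sets_free_at[OF that intersection_closed_top[OF F(2)] F(1)] .
  have free: "\<exists>Z :: 'u set. is_aleph (four_point_rank X \<F>) Z \<and> free_at Z \<F>"
    using free_at_four_point_rank[OF universe X F] .
  show "fr TYPE('u) \<F> = four_point_rank X \<F>"
    unfolding fr_def by (rule Least_equality) (use free nested four_point_rank_le[OF fin] in blast)+
  show "no X \<F> = four_point_rank X \<F>"
    unfolding no_def by (rule Least_equality) (use free nested four_point_rank_le[OF fin] in blast)+
qed

theorem theorem5p3:
  fixes X :: "nat set" and \<F> :: "nat set set"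
  assumes universe: "\<exists>Z :: 'u set. is_aleph 3 Z"
    and X: "X = {1, 2, 3, 4}"
    and family: "\<F> \<subseteq> Pow X"
  shows "fr TYPE('u) \<F> = no X \<F> \<and>
    (intersection_closed X \<F> \<longrightarrow>
      (fr TYPE('u) \<F> = 0 \<and> no X \<F> = 0 \<longleftrightarrow> linearly_ordered \<F>) \<and>
      (fr TYPE('u) \<F> = 3 \<and> no X \<F> = 3 \<longleftrightarrow> \<F> = Pow X) \<and>
      (fr TYPE('u) \<F> = 2 \<and> no X \<F> = 2 \<longleftrightarrow> \<F> \<noteq> Pow X \<and> contains_cycle X \<F>) \<and>
      (fr TYPE('u) \<F> = 1 \<and> no X \<F> = 1 \<longleftrightarrow>
         \<not> linearly_ordered \<F> \<and> \<F> \<noteq> Pow X \<and> \<not> (\<F> \<noteq> Pow X \<and> contains_cycle X \<F>)))"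
proof -
  have points: "distinct [1, 2, 3, 4 :: nat]" by simp
  have "finite X" using X by simp
  then have general: "fr TYPE('u) \<F> = no X \<F>"
    using fr_no_eq_four_point_rank[OF universe X points intersection_closure_subset
        intersection_closed_closure, of \<F>]
      fr_intersection_closure[OF family, where 'u = 'u] no_intersection_closure[OF family] by simp
  have Pow_cycle: "contains_cycle X (Pow X)"
    using acyclic_triangle[of X "Pow X" 1 2 3 4] X by auto
  show ?thesis
  proof (intro conjI impI)
    show "fr TYPE('u) \<F> = no X \<F>" by (rule general)
    assume closed: "intersection_closed X \<F>"
    note rank = fr_no_eq_four_point_rank[OF universe X points family closed]
    have "linearly_ordered \<F> \<Longrightarrow> \<not> contains_cycle X \<F>" "\<not> contains_cycle X \<F> \<Longrightarrow> \<F> \<noteq> Pow X"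
      using linearly_ordered_acyclic Pow_cycle by auto
    then show "fr TYPE('u) \<F> = 0 \<and> no X \<F> = 0 \<longleftrightarrow> linearly_ordered \<F>"
      "fr TYPE('u) \<F> = 3 \<and> no X \<F> = 3 \<longleftrightarrow> \<F> = Pow X"
      "fr TYPE('u) \<F> = 2 \<and> no X \<F> = 2 \<longleftrightarrow> \<F> \<noteq> Pow X \<and> contains_cycle X \<F>"
      "fr TYPE('u) \<F> = 1 \<and> no X \<F> = 1 \<longleftrightarrow>
         \<not> linearly_ordered \<F> \<and> \<F> \<noteq> Pow X \<and> \<not> (\<F> \<noteq> Pow X \<and> contains_cycle X \<F>)"
      unfolding rank four_point_rank_def by auto
  qed
qed

end
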